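(* Fix a hierarchical tensor format on $\mathcal{H}_d=\bigotimes_{i=1}^d\mathbb{R}^{n_i}$, a multi-linear rank $\mathbf{r}$ with all entries $r_\alpha\ge 1$, a retraction $R$ on the manifold $\mathcal{M}_{\mathbf{r}}$, and a linear map $\mathcal{A}:\mathcal{H}_d\to\mathbb{R}^m$ satisfying the tensor restricted isometry property of order $3\mathbf{r}$ with $\delta_{3\mathbf{r}}\le\delta<1$. Let $\mathbf{u}\in\mathcal{M}_{\le\mathbf{r}}$ and $\mathbf{b}=\mathcal{A}\mathbf{u}$. Then there exists $\varepsilon_0>0$ such that for every $\varepsilon\in(0,\varepsilon_0]$ there exists $\rho\in(0,1)$ (depending on $\delta$ and $\varepsilon$) with the following property. For every initial guess $\mathbf{u}^0\in\mathcal{M}_{\mathbf{r}}$ with $$\|\mathbf{u}-\mathbf{u}^0\|\le\varepsilon<\operatorname{dist}(\mathbf{u}^0,\partial\mathcal{M}_{\mathbf{r}}),$$ the iterates of the Riemannian gradient iteration $$\mathbf{y}^{n+1}:=\mathbf{u}^n+\mathcal{A}^*(\mathbf{b}-\mathcal{A}\mathbf{u}^n),\qquad \mathbf{u}^{n+1}:=R\big(\mathbf{u}^n,\;P_{\mathcal{T}_{\mathbf{u}^n}}\mathbf{y}^{n+1}-\mathbf{u}^n\big),\qquad n=0,1,2,\dots,$$ converge linearly to $\mathbf{u}$ with rate $\rho$, i.e. $$\|\mathbf{u}^{n+1}-\mathbf{u}\|\le\rho\,\|\mathbf{u}^n-\mathbf{u}\|\qquad\text{for all } n\ge 0 .$$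
   Context: **Tensor space.** Let $d\ge2$ and $n_1,\dots,n_d\ge1$. $\mathcal{H}_d=\bigotimes_{i=1}^d\mathbb{R}^{n_i}=\mathbb{R}^{n_1\times\cdots\times n_d}$ carries the Euclidean inner product $\langle\mathbf{u},\mathbf{v}\rangle=\sum_{\mu_1,\dots,\mu_d}\mathbf{u}(\mu_1,\dots,\mu_d)\mathbf{v}(\mu_1,\dots,\mu_d)$ and norm $\|\cdot\|$; $\mathbb{R}^m$ carries the Euclidean norm, and $\mathcal{A}^*$ is the adjoint of $\mathcal{A}$. **Hierarchical format and multi-linear rank.** Let $D=\{1,\dots,d\}$. A dimension tree is a rooted tree whose nodes are nonempty subsets of $D$, with root $D$, with leaves $\{1\},\dots,\{d\}$, and such that every non-leaf node is the disjoint union of its sons (two or more). For a subset $\alpha\subsetneq D$, the matricisation $\mathbf{U}^\alpha$ of $\mathbf{u}\in\mathcal{H}_d$ is the matrix with row index $(\mu_i)_{i\in\alpha}$, column index $(\mu_j)_{j\in D\setminus\alpha}$ and entries $\mathbf{u}(\mu_1,\dots,\mu_d)$. A hierarchical tensor format is given by a dimension tree $\mathbb{T}$; its ranks are indexed by the non-root nodes $\alpha$ of $\mathbb{T}$ (the root is omitted). Special cases are the Tucker format (the root has the $d$ leaves as sons) and the tensor train (TT) format (the nodes whose ranks are considered are only $\{1,\dots,i\}$, $i=1,\dots,d-1$). The multi-linear rank of $\mathbf{u}$ is the tuple $(\operatorname{rank}\mathbf{U}^\alpha)_\alpha$ over the nodes considered. For a tuple $\mathbf{r}=(r_\alpha)_\alpha$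 of positive integers, $\mathcal{M}_{\mathbf{r}}$ is the set of tensors of multi-linear rank exactly $\mathbf{r}$, and $\mathcal{M}_{\le\mathbf{r}}$ is the set of tensors with $\operatorname{rank}\mathbf{U}^\alpha\le r_\alpha$ for all nodes $\alpha$ considered. $3\mathbf{r}$ denotes $(3r_\alpha)_\alpha$. **Manifold structure.** It is a known fact that $\mathcal{M}_{\mathbf{r}}$ (when nonempty) is a smooth (analytic) embedded submanifold of $\mathcal{H}_d$ with closure $\mathcal{M}_{\le\mathbf{r}}$. $\mathcal{T}_{\mathbf{v}}\subset\mathcal{H}_d$ denotes its tangent space (a linear subspace) at $\mathbf{v}\in\mathcal{M}_{\mathbf{r}}$, and $P_{\mathcal{T}_{\mathbf{v}}}$ the orthogonal projection of $\mathcal{H}_d$ onto $\mathcal{T}_{\mathbf{v}}$. The set of singular points is $\partial\mathcal{M}_{\mathbf{r}}:=\mathcal{M}_{\le\mathbf{r}}\setminus\mathcal{M}_{\mathbf{r}}$, and $\operatorname{dist}$ is the Euclidean distance to a set. It is also known that $\mathbf{v}\in\mathcal{T}_{\mathbf{v}}$ and $\mathcal{T}_{\mathbf{v}}\subset\mathcal{M}_{\le2\mathbf{r}}$ for $\mathbf{v}\in\mathcal{M}_{\mathbf{r}}$. **Retraction.** A retraction is a twice differentiable map $R:(\mathbf{v},\boldsymbol{\xi})\mapsto R(\mathbf{v},\boldsymbol{\xi})\in\mathcal{M}_{\mathbf{r}}$, defined for $\mathbf{v}\in\mathcal{M}_{\mathbf{r}}$, $\boldsymbol{\xi}\in\mathcal{T}_{\mathbf{v}}$,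 with $R(\mathbf{v},\mathbf{0})=\mathbf{v}$ and, for $\|\boldsymbol{\xi}\|$ sufficiently small, $\|\mathbf{v}+\boldsymbol{\xi}-R(\mathbf{v},\boldsymbol{\xi})\|=\mathcal{O}(\|\boldsymbol{\xi}\|^2)$ and $\|\mathbf{v}-R(\mathbf{v},\boldsymbol{\xi})\|=\mathcal{O}(\|\boldsymbol{\xi}\|)$. Here the constants in $\mathcal{O}$ and the smallness threshold are uniform for $\mathbf{v}$ in compact subsets of $\mathcal{M}_{\mathbf{r}}$. **Tensor restricted isometry property (TRIP).** The tensor restricted isometry constant $\delta_{3\mathbf{r}}$ of $\mathcal{A}$ is the smallest number such that $(1-\delta_{3\mathbf{r}})\|\mathbf{v}\|^2\le\|\mathcal{A}\mathbf{v}\|^2\le(1+\delta_{3\mathbf{r}})\|\mathbf{v}\|^2$ for all $\mathbf{v}\in\mathcal{M}_{\le3\mathbf{r}}$. *)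

theory Defs
  imports "HOL-Analysis.Analysis"
begin

(* R^{n_1 x ... x n_d} is the Euclidean space real^'i, where the finite type 'i is identified with
   the set of multi-indices by the bijection c. The coordinates of c p outside {1..d} are undefined,
   and for every d and n with all n i positive there is such a type 'i. *)
definition multi_indexing :: "nat \<Rightarrow> (nat \<Rightarrow> nat) \<Rightarrow> ('i \<Rightarrow> nat \<Rightarrow> nat) \<Rightarrow> bool"
  where "multi_indexing d n c \<longleftrightarrow> bij_betw c UNIV (PiE {1..d} (\<lambda>i. {1..n i}))"

definition entry :: "('i::finite \<Rightarrow> nat \<Rightarrow> nat) \<Rightarrow> real^'i \<Rightarrow> (nat \<Rightarrow> nat) \<Rightarrow> real"
  where "entry c u \<mu> = u $ inv c \<mu>"


(* A node of a dimension tree is the disjoint union of two or more nonempty sons, so no subset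
   occurs twice in a tree and nodes may be identified with subsets. *)
definition dimension_tree :: "nat \<Rightarrow> nat set set \<Rightarrow> (nat set \<Rightarrow> nat set set) \<Rightarrow> bool"
  where "dimension_tree d T sons \<longleftrightarrow>
    (\<forall>\<alpha>\<in>T. \<alpha> \<noteq> {} \<and> \<alpha> \<subseteq> {1..d}) \<and>
    {1..d} \<in> T \<and>
    (\<forall>\<alpha>\<in>T. sons \<alpha> \<subseteq> T \<and> {1..d} \<notin> sons \<alpha>) \<and>
    (\<forall>\<alpha>\<in>T - {{1..d}}. \<exists>!\<beta>. \<beta> \<in> T \<and> \<alpha> \<in> sons \<beta>) \<and>
    {\<alpha>\<in>T. sons \<alpha> = {}} = {{i} | i. i \<in> {1..d}} \<and>
    (\<forall>\<alpha>\<in>T. sons \<alpha> \<noteq> {} \<longrightarrow> card (sons \<alpha>) \<ge> 2 \<and> disjoint (sons \<alpha>) \<and> \<Union> (sons \<alpha>) = \<alpha>)"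

(* S is the set of nodes whose ranks are considered: all nodes but the root, except that the
   tensor train format drops the singletons {2}, ..., {d} of its tree. *)
definition hierarchical_format :: "nat \<Rightarrow> nat set set \<Rightarrow> bool"
  where "hierarchical_format d S \<longleftrightarrow>
    (\<exists>T sons. dimension_tree d T sons \<and> S = T - {{1..d}}) \<or>
    S = {{1..i} | i. i \<in> {1..d-1}}"


(* Row p stands for the row index (c p i) for i in \<alpha>, column q for the column index (c q j) for
   j not in \<alpha>. Rows (columns) whose multi-indices agree on \<alpha> (off \<alpha>) are repeated; the lemma
   below shows that this does not affect the rank. *)
definition matricisation :: "('i::finite \<Rightarrow> nat \<Rightarrow> nat) \<Rightarrow> nat set \<Rightarrow> real^'i \<Rightarrow> real^'i^'i"
  where "matricisation c \<alpha> u = (\<chi> p q. entry c u (override_on (c q) (c p) \<alpha>))"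

lemma rank_reindex_le:
  fixes M :: "real^'c::finite^'r::finite" and f :: "'s::finite \<Rightarrow> 'r" and g :: "'t::finite \<Rightarrow> 'c"
  shows "rank ((\<chi> a b. M $ f a $ g b) :: real^'t^'s) \<le> rank M"
proof -
  define P :: "real^'r^'s" where "P = (\<chi> a p. if p = f a then 1 else 0)"
  define Q :: "real^'t^'c" where "Q = (\<chi> q b. if q = g b then 1 else 0)"
  have "(\<chi> a b. M $ f a $ g b) = P ** (M ** Q)"
    by (simp add: vec_eq_iff P_def Q_def matrix_matrix_mult_def if_distrib if_distribR
        sum.delta cong: if_cong)
  then show ?thesis
    using rank_mul_le_right[of P "M ** Q"] rank_mul_le_left[of M Q] by simp
qed

lemma rank_matricisation:
  fixes c :: "'i::finite \<Rightarrow> nat \<Rightarrow> nat"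
    and f :: "'r::finite \<Rightarrow> nat \<Rightarrow> nat" and g :: "'c::finite \<Rightarrow> nat \<Rightarrow> nat"
  assumes c: "multi_indexing d n c" and n: "\<forall>i\<in>{1..d}. n i \<ge> 1" and \<alpha>: "\<alpha> \<subseteq> {1..d}"
    and f: "bij_betw f UNIV (PiE \<alpha> (\<lambda>i. {1..n i}))"
    and g: "bij_betw g UNIV (PiE ({1..d} - \<alpha>) (\<lambda>i. {1..n i}))"
  shows "rank (matricisation c \<alpha> u) =
    rank ((\<chi> a b. entry c u (override_on (g b) (f a) \<alpha>)) :: real^'c^'r)"
proof (rule antisym)
  let ?I = "\<lambda>i. {1..n i}"
  let ?N = "(\<chi> a b. entry c u (override_on (g b) (f a) \<alpha>)) :: real^'c^'r"
  have cr: "range c = PiE {1..d} ?I" using c by (simp add: multi_indexing_def bij_betw_def)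
  have fr: "range f = PiE \<alpha> ?I" and gr: "range g = PiE ({1..d} - \<alpha>) ?I"
    using f g by (simp_all add: bij_betw_def)
  have c': "c p \<in> PiE {1..d} ?I" for p using cr by blast
  have f': "f a \<in> PiE \<alpha> ?I" for a using fr by blast
  have g': "g b \<in> PiE ({1..d} - \<alpha>) ?I" for b using gr by blast
  have "\<forall>p. \<exists>a. f a = restrict (c p) \<alpha>"
  proof
    fix p
    have "restrict (c p) \<alpha> \<in> range f" unfolding fr using c'[of p] \<alpha> by (auto simp: PiE_iff)
    then show "\<exists>a. f a = restrict (c p) \<alpha>" by auto
  qed
  then obtain F where F: "\<And>p. f (F p) = restrict (c p) \<alpha>" by metis
  have "\<forall>q. \<exists>b. g b = restrict (c q) ({1..d} - \<alpha>)"
  proof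
    fix q
    have "restrict (c q) ({1..d} - \<alpha>) \<in> range g" unfolding gr using c'[of q] by (auto simp: PiE_iff)
    then show "\<exists>b. g b = restrict (c q) ({1..d} - \<alpha>)" by auto
  qed
  then obtain G where G: "\<And>q. g (G q) = restrict (c q) ({1..d} - \<alpha>)" by metis
  have "override_on (c q) (c p) \<alpha> = override_on (g (G q)) (f (F p)) \<alpha>" for p q
    using c'[of q] by (auto simp: F G override_on_def fun_eq_iff PiE_iff extensional_def)
  then have "matricisation c \<alpha> u = (\<chi> p q. ?N $ F p $ G q)"
    by (simp add: matricisation_def)
  then show "rank (matricisation c \<alpha> u) \<le> rank ?N"
    using rank_reindex_le[of ?N F G] by simp
  have "\<forall>a. \<exists>p. c p = override_on (override_on (\<lambda>_. undefined) (\<lambda>_. 1) {1..d}) (f a) \<alpha>"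
  proof
    fix a
    have "override_on (override_on (\<lambda>_. undefined) (\<lambda>_. 1) {1..d}) (f a) \<alpha> \<in> range c"
      unfolding cr using f'[of a] \<alpha> n
      by (fastforce simp: PiE_iff override_on_def extensional_def)
    then show "\<exists>p. c p = override_on (override_on (\<lambda>_. undefined) (\<lambda>_. 1) {1..d}) (f a) \<alpha>"
      by (metis rangeE)
  qed
  then obtain F' where
    F': "\<And>a. c (F' a) = override_on (override_on (\<lambda>_. undefined) (\<lambda>_. 1) {1..d}) (f a) \<alpha>" by metis
  have "\<forall>b. \<exists>q. c q = override_on (g b) (\<lambda>_. 1) \<alpha>"
  proof
    fix b
    have "override_on (g b) (\<lambda>_. 1) \<alpha> \<in> range c"
      unfolding cr using g'[of b] \<alpha> n
      by (fastforce simp: PiE_iff override_on_def extensional_def)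
    then show "\<exists>q. c q = override_on (g b) (\<lambda>_. 1) \<alpha>" by (metis rangeE)
  qed
  then obtain G' where G': "\<And>b. c (G' b) = override_on (g b) (\<lambda>_. 1) \<alpha>" by metis
  have "override_on (g b) (f a) \<alpha> = override_on (c (G' b)) (c (F' a)) \<alpha>" for a b
    by (auto simp: F' G' override_on_def fun_eq_iff)
  then have "?N = (\<chi> a b. matricisation c \<alpha> u $ F' a $ G' b)"
    by (simp add: matricisation_def)
  then show "rank ?N \<le> rank (matricisation c \<alpha> u)"
    using rank_reindex_le[of "matricisation c \<alpha> u" F' G'] by simp
qed


definition rank_eq_tensors ::
    "('i::finite \<Rightarrow> nat \<Rightarrow> nat) \<Rightarrow> nat set set \<Rightarrow> (nat set \<Rightarrow> nat) \<Rightarrow> (real^'i) set"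
  where "rank_eq_tensors c S r = {u. \<forall>\<alpha>\<in>S. rank (matricisation c \<alpha> u) = r \<alpha>}"

definition rank_le_tensors ::
    "('i::finite \<Rightarrow> nat \<Rightarrow> nat) \<Rightarrow> nat set set \<Rightarrow> (nat set \<Rightarrow> nat) \<Rightarrow> (real^'i) set"
  where "rank_le_tensors c S r = {u. \<forall>\<alpha>\<in>S. rank (matricisation c \<alpha> u) \<le> r \<alpha>}"

definition singular_tensors ::
    "('i::finite \<Rightarrow> nat \<Rightarrow> nat) \<Rightarrow> nat set set \<Rightarrow> (nat set \<Rightarrow> nat) \<Rightarrow> (real^'i) set"
  where "singular_tensors c S r = rank_le_tensors c S r - rank_eq_tensors c S r"


(* The velocities at v of C^1 curves in M; for an embedded submanifold M this is the tangent space,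
   as a linear subspace of the ambient space. *)
definition tangent_space :: "'a::euclidean_space set \<Rightarrow> 'a \<Rightarrow> 'a set"
  where "tangent_space M v = {\<xi>. \<exists>e>0. \<exists>\<gamma>. \<gamma> C1_differentiable_on {-e<..<e} \<and>
    \<gamma> ` {-e<..<e} \<subseteq> M \<and> \<gamma> 0 = v \<and> (\<gamma> has_vector_derivative \<xi>) (at 0)}"

definition tangent_bundle :: "'a::euclidean_space set \<Rightarrow> ('a \<times> 'a) set"
  where "tangent_bundle M = Sigma M (tangent_space M)"

definition orthogonal_projection :: "'a::euclidean_space set \<Rightarrow> 'a \<Rightarrow> 'a"
  where "orthogonal_projection T x = (THE y. y \<in> T \<and> (\<forall>z\<in>T. (x - y) \<bullet> z = 0))"


(* Differentiability on a subset that is a submanifold (here a tangent bundle) rather than open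
   is differentiability of local extensions to open subsets of the ambient space. *)
definition twice_differentiable_on ::
    "('a::euclidean_space \<Rightarrow> 'b::euclidean_space) \<Rightarrow> 'a set \<Rightarrow> bool"
  where "twice_differentiable_on f X \<longleftrightarrow>
    (\<forall>x\<in>X. \<exists>W F F'. open W \<and> x \<in> W \<and> (\<forall>y\<in>W \<inter> X. F y = f y) \<and>
      (\<forall>y\<in>W. (F has_derivative blinfun_apply (F' y)) (at y)) \<and> F' differentiable_on W)"

definition manifold_retraction :: "'a::euclidean_space set \<Rightarrow> ('a \<Rightarrow> 'a \<Rightarrow> 'a) \<Rightarrow> bool"
  where "manifold_retraction M R \<longleftrightarrow>
    (\<forall>v\<in>M. \<forall>\<xi>\<in>tangent_space M v. R v \<xi> \<in> M) \<and>
    twice_differentiable_on (\<lambda>(v, \<xi>). R v \<xi>) (tangent_bundle M) \<and>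
    (\<forall>v\<in>M. R v 0 = v) \<and>
    (\<forall>K. compact K \<and> K \<subseteq> M \<longrightarrow>
      (\<exists>C. \<exists>\<tau>>0. \<forall>v\<in>K. \<forall>\<xi>\<in>tangent_space M v. norm \<xi> \<le> \<tau> \<longrightarrow>
        norm (v + \<xi> - R v \<xi>) \<le> C * (norm \<xi>)\<^sup>2 \<and> norm (v - R v \<xi>) \<le> C * norm \<xi>))"


definition trip_constant ::
    "('i::finite \<Rightarrow> nat \<Rightarrow> nat) \<Rightarrow> nat set set \<Rightarrow> (nat set \<Rightarrow> nat) \<Rightarrow> (real^'i \<Rightarrow> real^'m) \<Rightarrow> real"
  where "trip_constant c S k A = (LEAST \<delta>. \<forall>v\<in>rank_le_tensors c S k.
    (1 - \<delta>) * (norm v)\<^sup>2 \<le> (norm (A v))\<^sup>2 \<and> (norm (A v))\<^sup>2 \<le> (1 + \<delta>) * (norm v)\<^sup>2)"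

primrec riemannian_gradient_iteration ::
    "'a::euclidean_space set \<Rightarrow> ('a \<Rightarrow> 'a \<Rightarrow> 'a) \<Rightarrow> ('a \<Rightarrow> 'b::euclidean_space) \<Rightarrow> 'b \<Rightarrow> 'a \<Rightarrow> nat \<Rightarrow> 'a"
  where
    "riemannian_gradient_iteration M R A b u0 0 = u0"
  | "riemannian_gradient_iteration M R A b u0 (Suc k) =
      (let v = riemannian_gradient_iteration M R A b u0 k;
           y = v + adjoint A (b - A v)
       in R v (orthogonal_projection (tangent_space M v) y - v))"

end

(* The constant \<epsilon>0 may depend on u, and if u is singular no initial guess is admissible, so the
   claim is local around a point u of the manifold M. There M is the image of a C^1 map \<Phi> fixing M
   pointwise: multiply x in every mode \<alpha>, larger \<alpha> first, by the projector
   X (1 + G (X - U))^(-1) G, where X and U are the matricisations of x and u and U G U = U.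
   Because the nodes are laminar, a later mode multiplication does not raise the ranks
   established by an earlier one. Tangent spaces are then the ranges of the derivative of \<Phi>,
   hence linear, and u - v is tangent at v up to an error o(|u - v|) that is uniform in v. On the
   tangent space, which lies in the tensors of rank at most 2r, the TRIP makes the norm of
   P A* A P - P at most \<delta>, where P projects onto it; the remaining terms and the retraction
   error are o(|u - v|). *)

theory Submission
  imports Defs
begin

text \<open>The mode projector comes from a kernel argument. Put W = 1 + G (X - U). If X k = 0, then
  U W k = U k - U G U k = 0, so an invertible W maps ker X injectively into ker U. Hence rank X >=
  rank U near U, and if the ranks agree, the kernels correspond under W and W^(-1) G is a
  generalized inverse of X. Its entries are rational in those of X, so the retraction
  \<open>\<Phi>\<close> is C^1 without any choice of bases or singular vectors. The same kernel
  inclusion bounds the ranks of \<open>\<Phi> x\<close> from below and shows that sets of bounded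
  rank are closed.

  Uniformity in v is essential because the iterate v moves while the neighbourhood is fixed around
  u: the linearization at v has to reach u. Continuity of the derivative of \<open>\<Phi>\<close>
  provides this.

  The gap 1 - \<delta> is divided as follows: one quarter pays for the curvature of the manifold,
  one quarter for the retraction error, and the remaining half makes the rate (1 + \<delta>) /
  2.\<close>

subsection \<open>Matrices of bounded rank\<close>

text \<open>The kernel is the orthogonal complement of the row space, whose dimension is the
  rank.\<close>

lemma rank_plus_nullity:
  fixes X :: "real^'n^'m"
  shows "rank X + dim {x. X *v x = 0} = CARD('n)"
proof -
  have row: "X *v x = 0 \<longleftrightarrow> (\<forall>y\<in>rows X. orthogonal x y)" for x
    by (auto simp: rows_def row_def orthogonal_def vec_eq_iff matrix_vector_mult_def inner_vec_def
        mult.commute)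
  have "{x. X *v x = 0} = {y \<in> UNIV. \<forall>x\<in>span (rows X). orthogonal x y}"
    unfolding row by (auto simp: orthogonal_commute orthogonal_to_span span_base)
  moreover have "dim {y \<in> UNIV. \<forall>x\<in>span (rows X). orthogonal x y} + dim (span (rows X))
      = dim (UNIV :: (real^'n) set)"
    by (rule dim_subspace_orthogonal_to_vectors) auto
  ultimately show ?thesis by (simp add: row_rank_def)
qed

lemma matrix_inv_nonsingular:
  fixes W :: "real^'n^'n"
  assumes "det W \<noteq> 0"
  shows "W ** matrix_inv W = mat 1" "matrix_inv W ** W = mat 1"
proof -
  have "\<exists>B. W ** B = mat 1 \<and> B ** W = mat 1"
    using assms by (simp add: invertible_det_nz flip: invertible_def)
  then have "W ** matrix_inv W = mat 1 \<and> matrix_inv W ** W = mat 1"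
    unfolding matrix_inv_def by (rule someI_ex)
  then show "W ** matrix_inv W = mat 1" "matrix_inv W ** W = mat 1" by auto
qed

text \<open>Replacing any generalized inverse \<open>H\<close> by \<open>H ** U ** H\<close> keeps
  the equation and makes \<open>U\<close> a factor, which gives the rank bound. The bound passes on
  to the mode projectors, whose last factor is \<open>G\<close>.\<close>

lemma generalized_inverse_exists:
  fixes U :: "real^'n^'m"
  obtains G :: "real^'m^'n" where "U ** G ** U = U" "rank G \<le> rank U"
proof -
  obtain g where g: "linear g" "\<forall>v\<in>((*v) U) ` UNIV. U *v (g v) = v"
    using linear_exists_right_inverse_on[of "(*v) U" UNIV] by auto
  define H where "H = matrix g"
  have H: "U ** H ** U = U"
    using g by (simp add: H_def matrix_eq matrix_vector_mul_assoc [symmetric] matrix_works)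
  show thesis
  proof
    show "U ** (H ** U ** H) ** U = U" using H by (metis matrix_mul_assoc)
    show "rank (H ** U ** H) \<le> rank U"
      by (meson order_trans rank_mul_le_left rank_mul_le_right)
  qed
qed

lemma kernel_under_perturbation:
  fixes U X G :: "real^'n^'n"
  assumes UGU: "U ** G ** U = U" and k: "X *v k = 0"
  shows "U *v ((mat 1 + G ** (X - U)) *v k) = 0"
proof -
  have "(G ** (X - U)) *v k = G *v (X *v k - U *v k)"
    by (simp only: matrix_vector_mul_assoc [symmetric] matrix_vector_mult_diff_rdistrib)
  then have "(mat 1 + G ** (X - U)) *v k = k + G *v (- (U *v k))"
    by (simp add: matrix_vector_mult_add_rdistrib k)
  then have "U *v ((mat 1 + G ** (X - U)) *v k) = U *v k - U *v (G *v (U *v k))"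
    by (simp add: matrix_vector_right_distrib vec.neg matrix_vector_mult_diff_distrib)
  also have "\<dots> = 0"
    using UGU by (metis matrix_vector_mul_assoc diff_self)
  finally show ?thesis .
qed

text \<open>The injective image of ker X lies in ker U, so the nullity of X is at most that of U.
  Equal ranks give equal dimensions, and the inclusion becomes an equality.\<close>

lemma kernel_image_under_perturbation:
  fixes U X G :: "real^'n^'n"
  assumes "U ** G ** U = U" and "det (mat 1 + G ** (X - U)) \<noteq> 0"
  shows "rank U \<le> rank X"
    and "rank X = rank U \<Longrightarrow>
      (*v) (mat 1 + G ** (X - U)) ` {k. X *v k = 0} = {k. U *v k = 0}"
proof -
  let ?W = "mat 1 + G ** (X - U)"
  have inj: "inj ((*v) ?W)"
    using assms(2) by (simp add: inj_matrix_vector_mult invertible_det_nz)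
  have sub: "(*v) ?W ` {k. X *v k = 0} \<subseteq> {k. U *v k = 0}"
    using kernel_under_perturbation[OF assms(1)] by auto
  have dim: "dim ((*v) ?W ` {k. X *v k = 0}) = dim {k. X *v k = 0}"
    by (intro dim_image_eq matrix_vector_mul_linear inj_on_subset[OF inj]) simp
  from dim_subset[OF sub] dim have "dim {k. X *v k = 0} \<le> dim {k. U *v k = 0}" by simp
  then show "rank U \<le> rank X"
    using rank_plus_nullity[of U] rank_plus_nullity[of X] by linarith
  assume "rank X = rank U"
  then have "dim {k. X *v k = 0} = dim {k. U *v k = 0}"
    using rank_plus_nullity[of U] rank_plus_nullity[of X] by linarith
  then show "(*v) ?W ` {k. X *v k = 0} = {k. U *v k = 0}"
    using sub dim
    by (intro subspace_dim_equal real_vector.linear_subspace_image) (simp_all add: linear_subspace_kernel)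
qed

text \<open>With W the perturbed identity: \<open>z - G U z\<close> lies in ker U, so it is
  \<open>W k\<close> for some k in ker X. Subtracting this from
  \<open>W z = z + G X z - G U z\<close> leaves \<open>W (z - k) = G X z\<close>. Thus W^(-1) G X z
  = z - k, and X maps this to X z.\<close>

lemma range_projector_fixes:
  fixes U X G :: "real^'n^'n"
  assumes UGU: "U ** G ** U = U" and det: "det (mat 1 + G ** (X - U)) \<noteq> 0"
    and rank: "rank X = rank U"
  shows "X ** (matrix_inv (mat 1 + G ** (X - U)) ** G) ** X = X"
proof -
  let ?W = "mat 1 + G ** (X - U)"
  have inv: "matrix_inv ?W ** ?W = mat 1"
    using det by (rule matrix_inv_nonsingular)
  have "(X ** (matrix_inv ?W ** G) ** X) *v z = X *v z" for z
  proof -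
    have "z - G *v (U *v z) \<in> {k. U *v k = 0}"
      using UGU by (simp add: matrix_vector_mult_diff_distrib) (metis matrix_vector_mul_assoc)
    then obtain k where k: "X *v k = 0" "?W *v k = z - G *v (U *v z)"
      unfolding kernel_image_under_perturbation(2)[OF UGU det rank, symmetric] by auto
    have "?W *v z = z + G *v (X *v z) - G *v (U *v z)"
      by (simp only: matrix_vector_mul_assoc [symmetric] matrix_vector_mult_diff_rdistrib
          matrix_vector_mult_add_rdistrib matrix_vector_mult_diff_distrib matrix_vector_mul_lid
          add_diff_eq)
    then have "?W *v (z - k) = G *v (X *v z)"
      using k by (simp add: matrix_vector_mult_diff_distrib)
    then have "matrix_inv ?W *v (G *v (X *v z)) = z - k"
      by (metis inv matrix_vector_mul_assoc matrix_vector_mul_lid)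
    then show ?thesis
      using k by (simp add: matrix_vector_mult_diff_distrib flip: matrix_vector_mul_assoc)
  qed
  then show ?thesis by (simp add: matrix_eq)
qed

text \<open>Cramer's rule, which reduces differentiability of the inverse to that of determinants
  and a reciprocal.\<close>

lemma matrix_inv_component:
  fixes W :: "real^'n^'n"
  assumes "det W \<noteq> 0"
  shows "matrix_inv W $ k $ q = det (\<chi> i j. if j = k then axis q 1 $ i else W $ i $ j) / det W"
proof -
  have "W *v (matrix_inv W *v axis q 1) = axis q 1"
    using assms by (simp add: matrix_vector_mul_assoc matrix_inv_nonsingular)
  then have "matrix_inv W *v axis q 1 = (\<chi> k. det (\<chi> i j. if j = k then axis q 1 $ i else W $ i $ j) / det W)"
    using cramer[OF assms] by blast
  then show ?thesis
    by (simp add: vec_eq_iff matrix_vector_mult_basis column_def)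
qed

subsection \<open>Mode multiplication and laminar formats\<close>

text \<open>The position in the tensor of entry (p, q) of its \<alpha>-matricisation. Identities
  between matricisations thereby become identities between merged positions.\<close>

definition merge_index :: "('i \<Rightarrow> nat \<Rightarrow> nat) \<Rightarrow> nat set \<Rightarrow> 'i \<Rightarrow> 'i \<Rightarrow> 'i"
  where "merge_index c \<alpha> p q = inv c (override_on (c q) (c p) \<alpha>)"

(* P stands for a matrix with one row for each multi-index on \<alpha>, repeated for all p that agree on
   \<alpha> (see acts_on_mode). Its columns are not repeated: those that agree on \<alpha> add up. *)
definition mode_mult :: "('i::finite \<Rightarrow> nat \<Rightarrow> nat) \<Rightarrow> nat set \<Rightarrow> real^'i^'i \<Rightarrow> real^'i \<Rightarrow> real^'i"
  where "mode_mult c \<alpha> P z = (\<chi> p. \<Sum>s\<in>UNIV. P $ p $ s * z $ merge_index c \<alpha> s p)"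

definition acts_on_mode :: "('i::finite \<Rightarrow> nat \<Rightarrow> nat) \<Rightarrow> nat set \<Rightarrow> real^'i^'i \<Rightarrow> bool"
  where "acts_on_mode c \<alpha> P \<longleftrightarrow> (\<forall>p p'. (\<forall>i\<in>\<alpha>. c p i = c p' i) \<longrightarrow> P $ p = P $ p')"

lemma matricisation_component: "matricisation c \<alpha> u $ p $ q = u $ merge_index c \<alpha> p q"
  by (simp add: matricisation_def entry_def merge_index_def)

lemma matricisation_scaleR: "matricisation c \<alpha> (a *\<^sub>R u) = a *\<^sub>R matricisation c \<alpha> u"
  by (simp add: vec_eq_iff matricisation_component)

lemma matricisation_diff: "matricisation c \<alpha> (u - v) = matricisation c \<alpha> u - matricisation c \<alpha> v"
  by (simp add: vec_eq_iff matricisation_component)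

context
  fixes c :: "'i::finite \<Rightarrow> nat \<Rightarrow> nat" and d :: nat and n :: "nat \<Rightarrow> nat"
  assumes c: "multi_indexing d n c"
begin

lemma multi_index_merge:
  assumes "\<alpha> \<subseteq> {1..d}"
  shows "c (merge_index c \<alpha> p q) = override_on (c q) (c p) \<alpha>"
proof -
  have cr: "range c = PiE {1..d} (\<lambda>i. {1..n i})"
    using c by (simp add: multi_indexing_def bij_betw_def)
  then have "c p \<in> PiE {1..d} (\<lambda>i. {1..n i})" "c q \<in> PiE {1..d} (\<lambda>i. {1..n i})" by blast+
  then have "override_on (c q) (c p) \<alpha> \<in> range c"
    using assms unfolding cr by (auto simp: PiE_iff override_on_def extensional_def)
  then show ?thesis unfolding merge_index_def by (rule f_inv_into_f)
qed

lemma merge_eqI: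
  assumes "c p = c q"
  shows "p = q"
  using assms c by (auto simp: multi_indexing_def bij_betw_def inj_on_def)

lemma merge_merge_same:
  assumes "\<alpha> \<subseteq> {1..d}"
  shows "merge_index c \<alpha> s (merge_index c \<alpha> p q) = merge_index c \<alpha> s q"
  using assms by (intro merge_eqI) (auto simp: multi_index_merge override_on_def)

lemma merge_merge_subset:
  assumes "\<alpha> \<subseteq> \<beta>" "\<beta> \<subseteq> {1..d}"
  shows "merge_index c \<alpha> s (merge_index c \<beta> p q) = merge_index c \<beta> (merge_index c \<alpha> s p) q"
  using assms by (intro merge_eqI) (auto simp: multi_index_merge override_on_def fun_eq_iff)

lemma merge_merge_disjoint:
  assumes "\<alpha> \<inter> \<beta> = {}" "\<alpha> \<subseteq> {1..d}" "\<beta> \<subseteq> {1..d}"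
  shows "merge_index c \<alpha> s (merge_index c \<beta> p q) = merge_index c \<beta> p (merge_index c \<alpha> s q)"
  using assms by (intro merge_eqI) (auto simp: multi_index_merge override_on_def fun_eq_iff)

lemma acts_on_mode_matricisation_mult:
  assumes "\<alpha> \<subseteq> {1..d}"
  shows "acts_on_mode c \<alpha> (matricisation c \<alpha> x ** Y)"
  unfolding acts_on_mode_def
proof (intro allI impI)
  fix p p' assume "\<forall>i\<in>\<alpha>. c p i = c p' i"
  then have "override_on f (c p) \<alpha> = override_on f (c p') \<alpha>" for f
    by (auto simp: override_on_def)
  then show "(matricisation c \<alpha> x ** Y) $ p = (matricisation c \<alpha> x ** Y) $ p'"
    by (simp add: vec_eq_iff matrix_matrix_mult_def matricisation_component merge_index_def)
qed

lemma matricisation_mode_mult: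
  assumes "acts_on_mode c \<alpha> P" "\<alpha> \<subseteq> {1..d}"
  shows "matricisation c \<alpha> (mode_mult c \<alpha> P z) = P ** matricisation c \<alpha> z"
proof -
  have "P $ merge_index c \<alpha> p q = P $ p" for p q
    using assms by (auto simp: acts_on_mode_def multi_index_merge override_on_def)
  then show ?thesis
    using assms(2)
    by (simp add: vec_eq_iff matricisation_component mode_mult_def matrix_matrix_mult_def
        merge_merge_same)
qed

text \<open>The diagonal of the \<alpha>-matricisation already lists the whole tensor, since merging
  \<open>p\<close> with itself gives \<open>p\<close>. Entry \<open>p\<close> of the mode product is
  entry (p, p) of the matrix product.\<close>

lemma mode_mult_eqI:
  assumes "P ** matricisation c \<alpha> z = matricisation c \<alpha> z" "\<alpha> \<subseteq> {1..d}"
  shows "mode_mult c \<alpha> P z = z"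
proof -
  have self: "merge_index c \<alpha> p p = p" for p
    using assms(2) by (intro merge_eqI) (auto simp: multi_index_merge override_on_def)
  have "mode_mult c \<alpha> P z $ p = (P ** matricisation c \<alpha> z) $ p $ p" for p
    by (simp add: mode_mult_def matrix_matrix_mult_def matricisation_component)
  then show ?thesis
    using assms(1) by (simp add: vec_eq_iff matricisation_component self)
qed

text \<open>Seen in the \<beta>-matricisation, the mode multiplication is a matrix product: from the
  left if \<alpha> consists of row modes, from the right if it consists of column modes. An \<alpha>
  that meets both \<beta> and its complement would mix rows with columns; the order of the modes is
  chosen to avoid this.\<close>

lemma rank_mode_mult_le:
  assumes P: "acts_on_mode c \<alpha> P" and "\<alpha> \<subseteq> {1..d}" "\<beta> \<subseteq> {1..d}"
    and nested: "\<alpha> \<subseteq> \<beta> \<or> \<alpha> \<inter> \<beta> = {}"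
  shows "rank (matricisation c \<beta> (mode_mult c \<alpha> P z)) \<le> rank (matricisation c \<beta> z)"
  using nested
proof
  assume sub: "\<alpha> \<subseteq> \<beta>"
  \<comment> \<open>\<open>P\<close> tensored with the identity on the modes outside \<alpha>.
    Several \<open>s\<close> yield the same merged index, and their columns of \<open>P\<close> add
    up.\<close>
  let ?G = "(\<chi> p t. \<Sum>s | merge_index c \<alpha> s p = t. P $ p $ s) :: real^'i^'i"
  have row: "P $ merge_index c \<beta> p q = P $ p" for p q
  proof -
    have "\<forall>i\<in>\<alpha>. c (merge_index c \<beta> p q) i = c p i"
      using sub assms by (auto simp: multi_index_merge override_on_def)
    then show ?thesis using P by (simp add: acts_on_mode_def)
  qed
  have "matricisation c \<beta> (mode_mult c \<alpha> P z) $ p $ q = (?G ** matricisation c \<beta> z) $ p $ q" for p q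
  proof -
    have "(?G ** matricisation c \<beta> z) $ p $ q
        = (\<Sum>t\<in>UNIV. \<Sum>s\<in>{s\<in>UNIV. merge_index c \<alpha> s p = t}. P $ p $ s * z $ merge_index c \<beta> (merge_index c \<alpha> s p) q)"
      by (simp add: matrix_matrix_mult_def matricisation_component sum_distrib_right)
    also have "\<dots> = (\<Sum>s\<in>UNIV. P $ p $ s * z $ merge_index c \<beta> (merge_index c \<alpha> s p) q)"
      by (rule sum.group) auto
    finally show ?thesis
      using sub assms by (simp add: matricisation_component mode_mult_def row merge_merge_subset)
  qed
  then have "matricisation c \<beta> (mode_mult c \<alpha> P z) = ?G ** matricisation c \<beta> z"
    by (simp add: vec_eq_iff)
  then show ?thesis by (simp add: rank_mul_le_right)
next
  assume disj: "\<alpha> \<inter> \<beta> = {}"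
  let ?H = "(\<chi> t q. \<Sum>s | merge_index c \<alpha> s q = t. P $ q $ s) :: real^'i^'i"
  have row: "P $ merge_index c \<beta> p q = P $ q" for p q
  proof -
    have "\<forall>i\<in>\<alpha>. c (merge_index c \<beta> p q) i = c q i"
      using disj assms by (auto simp: multi_index_merge override_on_def)
    then show ?thesis using P by (simp add: acts_on_mode_def)
  qed
  have "matricisation c \<beta> (mode_mult c \<alpha> P z) $ p $ q = (matricisation c \<beta> z ** ?H) $ p $ q" for p q
  proof -
    have "(matricisation c \<beta> z ** ?H) $ p $ q
        = (\<Sum>t\<in>UNIV. \<Sum>s\<in>{s\<in>UNIV. merge_index c \<alpha> s q = t}. P $ q $ s * z $ merge_index c \<beta> p (merge_index c \<alpha> s q))"
      by (simp add: matrix_matrix_mult_def matricisation_component sum_distrib_left mult.commute)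
    also have "\<dots> = (\<Sum>s\<in>UNIV. P $ q $ s * z $ merge_index c \<beta> p (merge_index c \<alpha> s q))"
      by (rule sum.group) auto
    finally show ?thesis
      using disj assms by (simp add: matricisation_component mode_mult_def row merge_merge_disjoint[OF disj])
  qed
  then have "matricisation c \<beta> (mode_mult c \<alpha> P z) = matricisation c \<beta> z ** ?H"
    by (simp add: vec_eq_iff)
  then show ?thesis by (simp add: rank_mul_le_left)
qed

end

section \<open>Laminarity of dimension trees\<close>

lemma dimension_tree_laminar:
  assumes tree: "dimension_tree d T sons" and "\<alpha> \<in> T" "\<beta> \<in> T"
  shows "\<alpha> \<subseteq> \<beta> \<or> \<beta> \<subseteq> \<alpha> \<or> \<alpha> \<inter> \<beta> = {}"
proof -
  have sub: "\<And>\<alpha>. \<alpha> \<in> T \<Longrightarrow> \<alpha> \<noteq> {} \<and> \<alpha> \<subseteq> {1..d}" and root: "{1..d} \<in> T"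
    and sons: "\<And>\<alpha>. \<alpha> \<in> T \<Longrightarrow> sons \<alpha> \<subseteq> T \<and> {1..d} \<notin> sons \<alpha>"
    and parent: "\<And>\<alpha>. \<alpha> \<in> T \<Longrightarrow> \<alpha> \<noteq> {1..d} \<Longrightarrow> \<exists>!\<beta>. \<beta> \<in> T \<and> \<alpha> \<in> sons \<beta>"
    and split: "\<And>\<alpha>. \<alpha> \<in> T \<Longrightarrow> sons \<alpha> \<noteq> {} \<Longrightarrow>
      card (sons \<alpha>) \<ge> 2 \<and> disjoint (sons \<alpha>) \<and> \<Union> (sons \<alpha>) = \<alpha>"
    using tree unfolding dimension_tree_def by simp_all
  \<comment> \<open>The parent relation. The claim is proved for ancestry, the closure of
    \<open>E\<close>, instead of inclusion, because only ancestry can be combined with the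
    uniqueness of parents.\<close>
  define E where "E = {(\<alpha>, \<beta>). \<beta> \<in> T \<and> \<alpha> \<in> sons \<beta>}"
  have E_T: "\<alpha> \<in> T" "\<beta> \<in> T" "\<alpha> \<noteq> {1..d}" if "(\<alpha>, \<beta>) \<in> E" for \<alpha> \<beta>
    using that sons by (auto simp: E_def)
  have E_unique: "\<beta> = \<gamma>" if "(\<alpha>, \<beta>) \<in> E" "(\<alpha>, \<gamma>) \<in> E" for \<alpha> \<beta> \<gamma>
    using parent[OF E_T(1,3)[OF that(1)]] that by (auto simp: E_def)
  have E_less: "\<alpha> \<subset> \<beta>" if "(\<alpha>, \<beta>) \<in> E" for \<alpha> \<beta>
  proof -
    have \<beta>: "\<beta> \<in> T" "\<alpha> \<in> sons \<beta>" using that by (auto simp: E_def)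
    then have *: "card (sons \<beta>) \<ge> 2" "disjoint (sons \<beta>)" "\<Union> (sons \<beta>) = \<beta>"
      using split[OF \<beta>(1)] by auto
    have "sons \<beta> \<noteq> {\<alpha>}" using *(1) by auto
    then obtain \<gamma> where \<gamma>: "\<gamma> \<in> sons \<beta>" "\<gamma> \<noteq> \<alpha>" using \<beta> by blast
    then have "\<gamma> \<inter> \<alpha> = {}" using *(2) \<beta> by (auto dest: disjointD)
    moreover have "\<gamma> \<noteq> {}" using \<gamma> sub sons[OF \<beta>(1)] by blast
    ultimately show ?thesis using \<gamma> \<beta> *(3) by blast
  qed
  have E_le: "\<alpha> \<subseteq> \<beta>" if "(\<alpha>, \<beta>) \<in> E\<^sup>*" for \<alpha> \<beta>
    using that by (induction rule: rtrancl_induct) (auto dest: E_less)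
  have "(\<alpha>, \<beta>) \<in> E\<^sup>* \<or> (\<beta>, \<alpha>) \<in> E\<^sup>* \<or> \<alpha> \<inter> \<beta> = {}"
    using assms(2,3)
  \<comment> \<open>A parent is strictly larger than its son and has at most \<open>d\<close>
    elements, so the measure drops when either node is replaced by its parent.\<close>
  proof (induction "2 * d - (card \<alpha> + card \<beta>)" arbitrary: \<alpha> \<beta> rule: less_induct)
    case less
    have card_le: "card \<gamma> \<le> d" "finite \<gamma>" if "\<gamma> \<in> T" for \<gamma>
      using sub[OF that] card_mono[of "{1..d}" \<gamma>] finite_subset[of \<gamma> "{1..d}"] by auto
    have up: "\<exists>\<gamma>. (\<alpha>, \<gamma>) \<in> E" if "\<alpha> \<in> T" "\<alpha> \<noteq> {1..d}" for \<alpha>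
      using parent[OF that] unfolding E_def by blast
    have to_root: "(\<gamma>, {1..d}) \<in> E\<^sup>*" if "\<gamma> \<in> T" for \<gamma>
      using that
    proof (induction "d - card \<gamma>" arbitrary: \<gamma> rule: less_induct)
      case less
      show ?case
      proof (cases "\<gamma> = {1..d}")
        case False
        then obtain \<gamma>' where \<gamma>': "(\<gamma>, \<gamma>') \<in> E" using up less.prems by blast
        then have "card \<gamma> < card \<gamma>'"
          using E_less E_T card_le by (meson psubset_card_mono)
        then have "d - card \<gamma>' < d - card \<gamma>" using card_le(1)[OF E_T(2)[OF \<gamma>']] by linarith
        then show ?thesis
          using less.hyps E_T(2)[OF \<gamma>'] \<gamma>' by (meson converse_rtrancl_into_rtrancl)
      qed simp
    qed
    show ?case
    proof (cases "\<alpha> = {1..d} \<or> \<beta> = {1..d}")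
      case True
      then show ?thesis using to_root less.prems by blast
    next
      case False
      then obtain p q where p: "(\<alpha>, p) \<in> E" and q: "(\<beta>, q) \<in> E"
        using up less.prems by blast
      have cards: "card \<alpha> < card p" "card \<beta> < card q" "card p \<le> d" "card q \<le> d"
        using E_less[OF p] E_less[OF q] E_T(2)[OF p] E_T(2)[OF q] card_le
        by (meson psubset_card_mono)+
      have "card \<alpha> \<le> d" "card \<beta> \<le> d" using card_le less.prems by auto
      then have 1: "(p, \<beta>) \<in> E\<^sup>* \<or> (\<beta>, p) \<in> E\<^sup>* \<or> p \<inter> \<beta> = {}"
        using less.hyps[of p \<beta>] cards E_T(2)[OF p] less.prems by linarith
      have 2: "(\<alpha>, q) \<in> E\<^sup>* \<or> (q, \<alpha>) \<in> E\<^sup>* \<or> \<alpha> \<inter> q = {}"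
        using less.hyps[of \<alpha> q] cards \<open>card \<alpha> \<le> d\<close> \<open>card \<beta> \<le> d\<close> E_T(2)[OF q] less.prems by linarith
      have up_p: "\<alpha> = \<gamma> \<or> (p, \<gamma>) \<in> E\<^sup>*" if "(\<alpha>, \<gamma>) \<in> E\<^sup>*" for \<gamma>
        using that p E_unique by (metis converse_rtranclE)
      have up_q: "\<beta> = \<gamma> \<or> (q, \<gamma>) \<in> E\<^sup>*" if "(\<beta>, \<gamma>) \<in> E\<^sup>*" for \<gamma>
        using that q E_unique by (metis converse_rtranclE)
      have pq: "p = q" if "(p, q) \<in> E\<^sup>*" "(q, p) \<in> E\<^sup>*"
        using that E_le by blast
      have eq: "\<alpha> = \<beta> \<or> \<alpha> \<inter> \<beta> = {}" if "p = q"
        using p q that split[of p] by (auto simp: E_def dest: disjointD)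
      show ?thesis
        using 1
      proof (elim disjE)
        assume "(p, \<beta>) \<in> E\<^sup>*"
        then show ?thesis using p by (meson converse_rtrancl_into_rtrancl)
      next
        assume "p \<inter> \<beta> = {}"
        then show ?thesis using E_less[OF p] by blast
      next
        \<comment> \<open>The remaining case: \<open>p\<close> lies above \<beta> and
          \<open>q\<close> above \<alpha>. Unless one node is the parent of the other, uniqueness of
          parents puts \<open>p\<close> and \<open>q\<close> above each other. Then
          \<open>p = q\<close>, and \<alpha>, \<beta> are sons of one node.\<close>
        assume bp: "(\<beta>, p) \<in> E\<^sup>*"
        show ?thesis
          using 2
        proof (elim disjE)
          assume "(q, \<alpha>) \<in> E\<^sup>*"
          then show ?thesis using q by (meson converse_rtrancl_into_rtrancl)
        next
          assume "\<alpha> \<inter> q = {}"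
          then show ?thesis using E_less[OF q] by blast
        next
          assume aq: "(\<alpha>, q) \<in> E\<^sup>*"
          from up_p[OF aq] show ?thesis
          proof
            assume "\<alpha> = q"
            then show ?thesis using q by blast
          next
            assume pq1: "(p, q) \<in> E\<^sup>*"
            from up_q[OF bp] show ?thesis
            proof
              assume "\<beta> = p"
              then show ?thesis using p by blast
            next
              assume "(q, p) \<in> E\<^sup>*"
              then show ?thesis using eq pq[OF pq1] by blast
            qed
          qed
        qed
      qed
    qed
  qed
  then show ?thesis using E_le by blast
qed

lemma hierarchical_format_laminar:
  assumes "hierarchical_format d S"
  shows "finite S"
    and "\<alpha> \<in> S \<Longrightarrow> \<alpha> \<subseteq> {1..d}"
    and "\<alpha> \<in> S \<Longrightarrow> \<beta> \<in> S \<Longrightarrow> \<alpha> \<subseteq> \<beta> \<or> \<beta> \<subseteq> \<alpha> \<or> \<alpha> \<inter> \<beta> = {}"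
proof -
  have *: "S \<subseteq> Pow {1..d} \<and> (\<forall>\<alpha>\<in>S. \<forall>\<beta>\<in>S. \<alpha> \<subseteq> \<beta> \<or> \<beta> \<subseteq> \<alpha> \<or> \<alpha> \<inter> \<beta> = {})"
    using assms unfolding hierarchical_format_def
  proof (elim disjE exE conjE)
    fix T sons assume T: "dimension_tree d T sons" "S = T - {{1..d}}"
    then have "T \<subseteq> Pow {1..d}" by (auto simp: dimension_tree_def)
    then show ?thesis using T dimension_tree_laminar by blast
  next
    assume "S = {{1..i} | i. i \<in> {1..d-1}}"
    moreover have "{1..i} \<subseteq> {1..j} \<or> {1..j} \<subseteq> {1..i}" for i j :: nat
      by (cases "i \<le> j") auto
    ultimately show ?thesis by fastforce
  qed
  then show "finite S" by (meson finite_Pow_iff finite_atLeastAtMost finite_subset)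
  show "\<alpha> \<in> S \<Longrightarrow> \<alpha> \<subseteq> {1..d}" using * by blast
  show "\<alpha> \<in> S \<Longrightarrow> \<beta> \<in> S \<Longrightarrow> \<alpha> \<subseteq> \<beta> \<or> \<beta> \<subseteq> \<alpha> \<or> \<alpha> \<inter> \<beta> = {}" using * by blast
qed

subsection \<open>Local retraction onto the manifold\<close>

text \<open>Continuous differentiability, expressed by a gradient. Real-valued functions suffice:
  the entries of the retraction arise from tensor entries by sums, products and reciprocals, and the
  class is closed under these.\<close>

definition C1_scalar_on :: "'a::euclidean_space set \<Rightarrow> ('a \<Rightarrow> real) \<Rightarrow> bool"
  where "C1_scalar_on W f \<longleftrightarrow>
    (\<exists>g. continuous_on W g \<and> (\<forall>x\<in>W. (f has_derivative (\<lambda>h. g x \<bullet> h)) (at x)))"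

lemma C1_scalar_on_continuous: "C1_scalar_on W f \<Longrightarrow> continuous_on W f"
  unfolding C1_scalar_on_def
  by (meson continuous_at_imp_continuous_on has_derivative_continuous)

lemma C1_scalar_on_subset: "C1_scalar_on W f \<Longrightarrow> V \<subseteq> W \<Longrightarrow> C1_scalar_on V f"
  unfolding C1_scalar_on_def by (meson continuous_on_subset subsetD)

lemma C1_scalar_on_cong:
  assumes "open W" "\<And>x. x \<in> W \<Longrightarrow> f x = f' x" "C1_scalar_on W f"
  shows "C1_scalar_on W f'"
  using assms unfolding C1_scalar_on_def
  by (metis has_derivative_transform_within_open)

lemma C1_scalar_onI:
  assumes "continuous_on W g" "\<And>x. x \<in> W \<Longrightarrow> (f has_derivative D x) (at x)"
    and "\<And>x h. x \<in> W \<Longrightarrow> D x h = g x \<bullet> h"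
  shows "C1_scalar_on W f"
proof -
  have "D x = (\<lambda>h. g x \<bullet> h)" if "x \<in> W" for x
    using assms(3)[OF that] by blast
  then have "\<forall>x\<in>W. (f has_derivative (\<lambda>h. g x \<bullet> h)) (at x)"
    using assms(2) by simp
  then show ?thesis using assms(1) unfolding C1_scalar_on_def by blast
qed

lemma C1_scalar_onE:
  assumes "C1_scalar_on W f"
  obtains g where "continuous_on W g" "\<And>x. x \<in> W \<Longrightarrow> (f has_derivative (\<lambda>h. g x \<bullet> h)) (at x)"
  using assms unfolding C1_scalar_on_def by blast

lemma C1_scalar_on_const: "C1_scalar_on W (\<lambda>x. a)"
  by (rule C1_scalar_onI[of W "\<lambda>x. 0" _ "\<lambda>x h. 0"]) auto

lemma C1_scalar_on_component: "C1_scalar_on W (\<lambda>x::real^'i. x $ p)"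
  by (rule C1_scalar_onI[of W "\<lambda>x. axis p 1" _ "\<lambda>x h. h $ p"])
    (auto simp: inner_axis' intro!: bounded_linear_imp_has_derivative bounded_linear_vec_nth)

lemma C1_scalar_on_add:
  assumes "C1_scalar_on W f" "C1_scalar_on W g"
  shows "C1_scalar_on W (\<lambda>x. f x + g x)"
proof -
  obtain f' where f': "continuous_on W f'" "\<And>x. x \<in> W \<Longrightarrow> (f has_derivative (\<lambda>h. f' x \<bullet> h)) (at x)"
    using C1_scalar_onE[OF assms(1)] by blast
  obtain g' where g': "continuous_on W g'" "\<And>x. x \<in> W \<Longrightarrow> (g has_derivative (\<lambda>h. g' x \<bullet> h)) (at x)"
    using C1_scalar_onE[OF assms(2)] by blast
  show ?thesis
    by (rule C1_scalar_onI[of W "\<lambda>x. f' x + g' x", OF _ has_derivative_add[OF f'(2) g'(2)]])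
      (auto simp: inner_add_left intro!: continuous_intros f' g')
qed

lemma C1_scalar_on_mult:
  assumes "C1_scalar_on W f" "C1_scalar_on W g"
  shows "C1_scalar_on W (\<lambda>x. f x * g x)"
proof -
  obtain f' where f': "continuous_on W f'" "\<And>x. x \<in> W \<Longrightarrow> (f has_derivative (\<lambda>h. f' x \<bullet> h)) (at x)"
    using C1_scalar_onE[OF assms(1)] by blast
  obtain g' where g': "continuous_on W g'" "\<And>x. x \<in> W \<Longrightarrow> (g has_derivative (\<lambda>h. g' x \<bullet> h)) (at x)"
    using C1_scalar_onE[OF assms(2)] by blast
  show ?thesis
    by (rule C1_scalar_onI[of W "\<lambda>x. f x *\<^sub>R g' x + g x *\<^sub>R f' x",
          OF _ has_derivative_mult[OF f'(2) g'(2)]])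
      (auto simp: inner_add_left mult.commute
        intro!: continuous_intros f' g' C1_scalar_on_continuous assms)
qed

lemma C1_scalar_on_inverse:
  assumes "C1_scalar_on W f" "\<And>x. x \<in> W \<Longrightarrow> f x \<noteq> 0"
  shows "C1_scalar_on W (\<lambda>x. inverse (f x))"
proof -
  obtain f' where f': "continuous_on W f'" "\<And>x. x \<in> W \<Longrightarrow> (f has_derivative (\<lambda>h. f' x \<bullet> h)) (at x)"
    using C1_scalar_onE[OF assms(1)] by blast
  show ?thesis
    by (rule C1_scalar_onI[of W "\<lambda>x. (- (inverse (f x) * inverse (f x))) *\<^sub>R f' x",
          OF _ Deriv.has_derivative_inverse[OF assms(2) f'(2)]])
      (auto intro!: continuous_intros f' C1_scalar_on_continuous[OF assms(1)] dest: assms(2))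
qed

lemma C1_scalar_on_sum:
  assumes "\<And>a. a \<in> I \<Longrightarrow> C1_scalar_on W (f a)"
  shows "C1_scalar_on W (\<lambda>x. \<Sum>a\<in>I. f a x)"
  using assms
  by (induction I rule: infinite_finite_induct)
    (auto intro: C1_scalar_on_const C1_scalar_on_add)

lemma C1_scalar_on_prod:
  assumes "\<And>a. a \<in> I \<Longrightarrow> C1_scalar_on W (f a)"
  shows "C1_scalar_on W (\<lambda>x. \<Prod>a\<in>I. f a x)"
  using assms
  by (induction I rule: infinite_finite_induct)
    (auto intro: C1_scalar_on_const C1_scalar_on_mult)

lemmas C1_scalar_intros = C1_scalar_on_const C1_scalar_on_component C1_scalar_on_add
  C1_scalar_on_mult C1_scalar_on_inverse C1_scalar_on_sum C1_scalar_on_prod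

lemma C1_scalar_on_det:
  fixes W :: "'a::euclidean_space \<Rightarrow> real^'n^'n"
  assumes "\<And>i j. C1_scalar_on V (\<lambda>x. W x $ i $ j)"
  shows "C1_scalar_on V (\<lambda>x. det (W x))"
  unfolding det_def by (intro C1_scalar_intros assms)

lemma C1_scalar_on_matrix_mult:
  fixes P :: "'a::euclidean_space \<Rightarrow> real^'n^'m" and Q :: "'a \<Rightarrow> real^'k^'n"
  assumes "\<And>i j. C1_scalar_on V (\<lambda>x. P x $ i $ j)" "\<And>i j. C1_scalar_on V (\<lambda>x. Q x $ i $ j)"
  shows "C1_scalar_on V (\<lambda>x. (P x ** Q x) $ i $ j)"
  unfolding matrix_matrix_mult_def by (simp, intro C1_scalar_intros assms)

lemma C1_scalar_on_matrix_inv: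
  fixes W :: "'a::euclidean_space \<Rightarrow> real^'n^'n"
  assumes "open V" "\<And>i j. C1_scalar_on V (\<lambda>x. W x $ i $ j)" "\<And>x. x \<in> V \<Longrightarrow> det (W x) \<noteq> 0"
  shows "C1_scalar_on V (\<lambda>x. matrix_inv (W x) $ k $ q)"
proof (rule C1_scalar_on_cong[OF assms(1)])
  show "det (\<chi> i j. if j = k then axis q 1 $ i else W x $ i $ j) * inverse (det (W x))
      = matrix_inv (W x) $ k $ q" if "x \<in> V" for x
    using assms(3)[OF that] by (simp add: matrix_inv_component divide_inverse)
  have "C1_scalar_on V (\<lambda>x. (\<chi> i j. if j = k then axis q 1 $ i else W x $ i $ j) $ i $ j)" for i j
    by (cases "j = k") (simp_all add: C1_scalar_on_const assms(2))
  then show "C1_scalar_on V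
      (\<lambda>x. det (\<chi> i j. if j = k then axis q 1 $ i else W x $ i $ j) * inverse (det (W x)))"
    by (intro C1_scalar_on_mult C1_scalar_on_inverse C1_scalar_on_det assms)
qed

lemma C1_scalar_on_mode_mult:
  assumes "\<And>i j. C1_scalar_on V (\<lambda>x. P x $ i $ j)" "\<And>q. C1_scalar_on V (\<lambda>x. f x $ q)"
  shows "C1_scalar_on V (\<lambda>x. mode_mult c \<alpha> (P x) (f x) $ p)"
  unfolding mode_mult_def by (simp, intro C1_scalar_intros assms)

lemma C1_scalar_on_fold_mode_mult:
  assumes "\<And>\<alpha> i j. \<alpha> \<in> set \<alpha>s \<Longrightarrow> C1_scalar_on V (\<lambda>x. P \<alpha> x $ i $ j)"
    and "\<And>q. C1_scalar_on V (\<lambda>x. f x $ q)"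
  shows "C1_scalar_on V (\<lambda>x. fold (\<lambda>\<alpha>. mode_mult c \<alpha> (P \<alpha> x)) \<alpha>s (f x) $ p)"
  using assms
proof (induction \<alpha>s arbitrary: f)
  case (Cons \<alpha> \<alpha>s)
  then show ?case by (simp add: C1_scalar_on_mode_mult)
qed simp

section \<open>Assembly of the local retraction from the modes\<close>

lemma laminar_descending_list:
  assumes "finite S" and fin: "\<And>\<alpha>. \<alpha> \<in> S \<Longrightarrow> finite \<alpha>"
    and laminar: "\<And>\<alpha> \<beta>. \<alpha> \<in> S \<Longrightarrow> \<beta> \<in> S \<Longrightarrow> \<alpha> \<subseteq> \<beta> \<or> \<beta> \<subseteq> \<alpha> \<or> \<alpha> \<inter> \<beta> = {}"
  obtains \<alpha>s where "set \<alpha>s = S" "sorted_wrt (\<lambda>\<beta> \<alpha>. \<alpha> \<subseteq> \<beta> \<or> \<alpha> \<inter> \<beta> = {}) \<alpha>s"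
proof -
  obtain l where l: "set l = S" using \<open>finite S\<close> finite_list by blast
  have "sorted_wrt (\<lambda>\<alpha> \<beta>. card \<alpha> \<le> card \<beta>) (sort_key card l)"
    using sorted_sort_key[of card l] by (simp only: sorted_map)
  \<comment> \<open>If the larger node were contained in the smaller one, both would be equal.
    Reversing the list afterwards puts large nodes first.\<close>
  then have "sorted_wrt (\<lambda>\<alpha> \<beta>. \<alpha> \<subseteq> \<beta> \<or> \<alpha> \<inter> \<beta> = {}) (sort_key card l)"
  proof (rule sorted_wrt_mono_rel[rotated])
    fix \<alpha> \<beta> assume "\<alpha> \<in> set (sort_key card l)" "\<beta> \<in> set (sort_key card l)" "card \<alpha> \<le> card \<beta>"
    then show "\<alpha> \<subseteq> \<beta> \<or> \<alpha> \<inter> \<beta> = {}"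
      using laminar[of \<alpha> \<beta>] card_seteq[of \<alpha> \<beta>] fin[of \<alpha>] l by auto
  qed
  then show thesis
    using that[of "rev (sort_key card l)"] l by (simp add: sorted_wrt_rev)
qed

context
  fixes c :: "'i::finite \<Rightarrow> nat \<Rightarrow> nat" and d :: nat and n :: "nat \<Rightarrow> nat"
  assumes c: "multi_indexing d n c"
begin

lemma rank_fold_mode_mult_le:
  assumes "\<And>\<alpha>. \<alpha> \<in> set \<alpha>s \<Longrightarrow> acts_on_mode c \<alpha> (P \<alpha>) \<and> \<alpha> \<subseteq> {1..d}" "\<beta> \<subseteq> {1..d}"
    and "\<And>\<alpha>. \<alpha> \<in> set \<alpha>s \<Longrightarrow> \<alpha> \<subseteq> \<beta> \<or> \<alpha> \<inter> \<beta> = {}"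
  shows "rank (matricisation c \<beta> (fold (\<lambda>\<alpha>. mode_mult c \<alpha> (P \<alpha>)) \<alpha>s z))
    \<le> rank (matricisation c \<beta> z)"
  using assms
proof (induction \<alpha>s arbitrary: z)
  case (Cons \<alpha> \<alpha>s)
  have "rank (matricisation c \<beta> (fold (\<lambda>\<alpha>. mode_mult c \<alpha> (P \<alpha>)) (\<alpha> # \<alpha>s) z))
      \<le> rank (matricisation c \<beta> (mode_mult c \<alpha> (P \<alpha>) z))"
    using Cons by simp
  also have "\<dots> \<le> rank (matricisation c \<beta> z)"
    using Cons.prems by (intro rank_mode_mult_le[OF c]) auto
  finally show ?case .
qed simp

lemma rank_fold_projectors_le:
  assumes "\<And>\<alpha>. \<alpha> \<in> set \<alpha>s \<Longrightarrow> acts_on_mode c \<alpha> (P \<alpha>) \<and> \<alpha> \<subseteq> {1..d} \<and> rank (P \<alpha>) \<le> r \<alpha>"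
    and "sorted_wrt (\<lambda>\<beta> \<alpha>. \<alpha> \<subseteq> \<beta> \<or> \<alpha> \<inter> \<beta> = {}) \<alpha>s" and "\<beta> \<in> set \<alpha>s"
  shows "rank (matricisation c \<beta> (fold (\<lambda>\<alpha>. mode_mult c \<alpha> (P \<alpha>)) \<alpha>s z)) \<le> r \<beta>"
  using assms
proof (induction \<alpha>s arbitrary: z)
  case (Cons \<alpha> \<alpha>s)
  show ?case
  \<comment> \<open>The split singles out the last occurrence of \<beta> in the list. There the rank
    is cut down by \<open>P \<beta>\<close> whatever the tensor was before.\<close>
  proof (cases "\<beta> \<in> set \<alpha>s")
    case True
    then show ?thesis using Cons by simp
  next
    case False
    then have [simp]: "\<beta> = \<alpha>" using Cons.prems by simp
    have "rank (matricisation c \<alpha> (fold (\<lambda>\<alpha>. mode_mult c \<alpha> (P \<alpha>)) \<alpha>s (mode_mult c \<alpha> (P \<alpha>) z)))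
        \<le> rank (matricisation c \<alpha> (mode_mult c \<alpha> (P \<alpha>) z))"
      using Cons.prems by (intro rank_fold_mode_mult_le) auto
    also have "\<dots> \<le> rank (P \<alpha>)"
      using Cons.prems by (simp add: matricisation_mode_mult[OF c] rank_mul_le_left)
    also have "\<dots> \<le> r \<alpha>" using Cons.prems by simp
    finally show ?thesis by simp
  qed
qed simp

lemma rank_eq_tensors_local_retraction:
  assumes S: "hierarchical_format d S" and u: "u \<in> rank_eq_tensors c S r"
  obtains W \<Phi> where "open W" "u \<in> W"
    "\<And>x. x \<in> W \<Longrightarrow> \<Phi> x \<in> rank_eq_tensors c S r"
    "\<And>x. x \<in> W \<Longrightarrow> x \<in> rank_eq_tensors c S r \<Longrightarrow> \<Phi> x = x"
    "\<And>i. i \<in> Basis \<Longrightarrow> C1_scalar_on W (\<lambda>x. \<Phi> x \<bullet> i)"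
proof -
  let ?U = "\<lambda>\<alpha>. matricisation c \<alpha> u"
  note S_sub = hierarchical_format_laminar(2)[OF S]
  have "\<forall>\<alpha>. \<exists>G. ?U \<alpha> ** G ** ?U \<alpha> = ?U \<alpha> \<and> rank G \<le> rank (?U \<alpha>)"
    by (metis generalized_inverse_exists)
  then obtain G where G: "\<And>\<alpha>. ?U \<alpha> ** G \<alpha> ** ?U \<alpha> = ?U \<alpha>" "\<And>\<alpha>. rank (G \<alpha>) \<le> rank (?U \<alpha>)"
    by metis
  define Q where "Q \<alpha> x = mat 1 + G \<alpha> ** (matricisation c \<alpha> x - ?U \<alpha>)" for \<alpha> x
  \<comment> \<open>Every factor is computed from the original \<open>x\<close>, not from the
    intermediate tensors of the fold. At a point of the manifold each mode multiplication therefore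
    fixes \<open>x\<close> on its own.\<close>
  define P where "P \<alpha> x = matricisation c \<alpha> x ** (matrix_inv (Q \<alpha> x) ** G \<alpha>)" for \<alpha> x
  obtain \<alpha>s where \<alpha>s: "set \<alpha>s = S" "sorted_wrt (\<lambda>\<beta> \<alpha>. \<alpha> \<subseteq> \<beta> \<or> \<alpha> \<inter> \<beta> = {}) \<alpha>s"
  proof (rule laminar_descending_list[of S])
    show "finite \<alpha>" if "\<alpha> \<in> S" for \<alpha>
      using S_sub[OF that] finite_subset by blast
  qed (use hierarchical_format_laminar[OF S] in auto)
  define \<Phi> where "\<Phi> x = fold (\<lambda>\<alpha>. mode_mult c \<alpha> (P \<alpha> x)) \<alpha>s x" for x
  define V where "V = {x. \<forall>\<alpha>\<in>S. det (Q \<alpha> x) \<noteq> 0}"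
  have C1_mat: "C1_scalar_on X (\<lambda>x. matricisation c \<alpha> x $ i $ j)" for X \<alpha> i j
    by (simp add: matricisation_component C1_scalar_on_component)
  have C1_Q: "C1_scalar_on X (\<lambda>x. Q \<alpha> x $ i $ j)" for X \<alpha> i j
  proof -
    have "C1_scalar_on X (\<lambda>x. (mat 1 :: real^'i^'i) $ i $ j +
        (G \<alpha> ** (matricisation c \<alpha> x - ?U \<alpha>)) $ i $ j)"
      by (intro C1_scalar_on_add C1_scalar_on_const C1_scalar_on_matrix_mult)
        (simp only: diff_conv_add_uminus vector_add_component C1_scalar_on_add C1_mat C1_scalar_on_const)
    then show ?thesis by (simp add: Q_def)
  qed
  have "open V"
  proof -
    have "V = (\<Inter>\<alpha>\<in>S. {x. det (Q \<alpha> x) \<noteq> 0})" by (auto simp: V_def)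
    moreover have "open {x. det (Q \<alpha> x) \<noteq> 0}" for \<alpha>
      using C1_scalar_on_continuous[OF C1_scalar_on_det[OF C1_Q], of UNIV \<alpha>]
      by (intro open_Collect_neq continuous_on_const)
    ultimately show ?thesis using hierarchical_format_laminar(1)[OF S] by auto
  qed
  have "u \<in> V" by (simp add: V_def Q_def)
  have C1_P: "C1_scalar_on V (\<lambda>x. P \<alpha> x $ i $ j)" if "\<alpha> \<in> S" for \<alpha> i j
    unfolding P_def using that
    by (intro C1_scalar_on_matrix_mult C1_scalar_on_matrix_inv C1_mat C1_Q C1_scalar_on_const \<open>open V\<close>)
      (simp add: V_def)
  have C1_\<Phi>: "C1_scalar_on V (\<lambda>x. \<Phi> x $ p)" for p
    unfolding \<Phi>_def
    by (intro C1_scalar_on_fold_mode_mult C1_P C1_scalar_on_component) (simp add: \<alpha>s)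
  have \<Phi>_id: "\<Phi> x = x" if "x \<in> V" "x \<in> rank_eq_tensors c S r" for x
  proof -
    have fixed: "mode_mult c \<alpha> (P \<alpha> x) x = x" if "\<alpha> \<in> S" for \<alpha>
    proof (rule mode_mult_eqI[OF c _ S_sub[OF that]])
      have "rank (matricisation c \<alpha> x) = rank (?U \<alpha>)"
        using that u \<open>x \<in> rank_eq_tensors c S r\<close> by (simp add: rank_eq_tensors_def)
      then show "P \<alpha> x ** matricisation c \<alpha> x = matricisation c \<alpha> x"
        using \<open>x \<in> V\<close> that range_projector_fixes[OF G(1), of \<alpha> "matricisation c \<alpha> x"]
        by (simp add: P_def Q_def V_def)
    qed
    have "fold (\<lambda>\<alpha>. mode_mult c \<alpha> (P \<alpha> x)) l x = x" if "set l \<subseteq> S" for l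
      using that by (induction l) (auto simp: fixed)
    then show ?thesis by (simp add: \<Phi>_def \<alpha>s)
  qed
  have rank_le: "rank (matricisation c \<beta> (\<Phi> x)) \<le> r \<beta>" if "\<beta> \<in> S" for \<beta> x
    unfolding \<Phi>_def
  proof (rule rank_fold_projectors_le[OF _ \<alpha>s(2)])
    fix \<alpha> assume "\<alpha> \<in> set \<alpha>s"
    then have "\<alpha> \<in> S" by (simp add: \<alpha>s)
    have "rank (P \<alpha> x) \<le> rank (G \<alpha>)"
      unfolding P_def by (meson order_trans rank_mul_le_right)
    also have "\<dots> \<le> r \<alpha>" using G(2)[of \<alpha>] u \<open>\<alpha> \<in> S\<close> by (simp add: rank_eq_tensors_def)
    finally show "acts_on_mode c \<alpha> (P \<alpha> x) \<and> \<alpha> \<subseteq> {1..d} \<and> rank (P \<alpha> x) \<le> r \<alpha>"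
      using S_sub[OF \<open>\<alpha> \<in> S\<close>] unfolding P_def by (simp add: acts_on_mode_matricisation_mult[OF c])
  qed (use that \<alpha>s in simp)
  have rank_ge: "r \<beta> \<le> rank (matricisation c \<beta> x)" if "\<beta> \<in> S" "x \<in> V" for \<beta> x
    using that u kernel_image_under_perturbation(1)[OF G(1), of \<beta> "matricisation c \<beta> x"]
    by (simp add: rank_eq_tensors_def V_def Q_def)
  \<comment> \<open>The lower rank bound is needed at \<open>\<Phi> x\<close>, so this point has to
    lie in \<open>V\<close> as well. Together with the upper bound, which holds for all
    \<open>x\<close>, it makes the ranks exact.\<close>
  define W where "W = V \<inter> \<Phi> -` V"
  show thesis
  proof
    have "continuous_on V \<Phi>"
      using C1_scalar_on_continuous[OF C1_\<Phi>] continuous_on_vec_lambda[of V "\<lambda>p x. \<Phi> x $ p"] by simp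
    then have "open (\<Phi> -` V \<inter> V)"
      using continuous_on_open_vimage[OF \<open>open V\<close>] \<open>open V\<close> by blast
    then show "open W" by (simp add: W_def Int_commute)
    show "u \<in> W" using \<open>u \<in> V\<close> u by (simp add: W_def \<Phi>_id)
    show "\<Phi> x \<in> rank_eq_tensors c S r" if "x \<in> W" for x
    proof -
      have "rank (matricisation c \<beta> (\<Phi> x)) = r \<beta>" if "\<beta> \<in> S" for \<beta>
        using rank_le[OF that, of x] rank_ge[OF that, of "\<Phi> x"] \<open>x \<in> W\<close> by (simp add: W_def)
      then show ?thesis by (simp add: rank_eq_tensors_def)
    qed
    show "\<Phi> x = x" if "x \<in> W" "x \<in> rank_eq_tensors c S r" for x
      using that \<Phi>_id by (simp add: W_def)
    show "C1_scalar_on W (\<lambda>x. \<Phi> x \<bullet> i)" if i: "i \<in> Basis" for i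
    proof -
      obtain p where "i = axis p 1" using i unfolding Basis_vec_def Basis_real_def by blast
      then show ?thesis
        using C1_scalar_on_subset[OF C1_\<Phi>, of W p] by (simp add: W_def inner_axis)
    qed
  qed
qed

end

subsection \<open>Tangent spaces and the restricted isometry constant\<close>

text \<open>The last conclusion is strict differentiability: one radius serves all base points
  \<open>v\<close> near \<open>u\<close>. It is the mean value inequality on a ball in which the
  derivative varies by at most \<eta>.\<close>

lemma C1_components_derivative:
  fixes \<Phi> :: "'a::euclidean_space \<Rightarrow> 'a"
  assumes "open W" and C1: "\<And>i. i \<in> Basis \<Longrightarrow> C1_scalar_on W (\<lambda>x. \<Phi> x \<bullet> i)"
  obtains Q where "\<And>x. x \<in> W \<Longrightarrow> (\<Phi> has_derivative Q x) (at x)"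
    "\<And>h. continuous_on W (\<lambda>x. Q x h)"
    "\<And>u \<eta>. u \<in> W \<Longrightarrow> \<eta> > 0 \<Longrightarrow> \<exists>\<epsilon>>0. ball u \<epsilon> \<subseteq> W \<and>
      (\<forall>v\<in>ball u \<epsilon>. \<forall>w\<in>ball u \<epsilon>. norm (\<Phi> w - \<Phi> v - Q v (w - v)) \<le> \<eta> * norm (w - v))"
proof -
  have "\<forall>i\<in>Basis. \<exists>g. continuous_on W g \<and>
      (\<forall>x\<in>W. ((\<lambda>x. \<Phi> x \<bullet> i) has_derivative (\<lambda>h. g x \<bullet> h)) (at x))"
    using C1 unfolding C1_scalar_on_def by blast
  then obtain g where g: "\<And>i. i \<in> Basis \<Longrightarrow> continuous_on W (g i)"
    "\<And>i x. i \<in> Basis \<Longrightarrow> x \<in> W \<Longrightarrow> ((\<lambda>x. \<Phi> x \<bullet> i) has_derivative (\<lambda>h. g i x \<bullet> h)) (at x)"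
    by metis
  define Q where "Q x h = (\<Sum>i\<in>Basis. (g i x \<bullet> h) *\<^sub>R i)" for x h :: 'a
  have Q_inner: "Q x h \<bullet> i = g i x \<bullet> h" if "i \<in> Basis" for x h i
    using that by (simp add: Q_def inner_sum_left inner_Basis if_distrib sum.delta cong: if_cong)
  have deriv: "(\<Phi> has_derivative Q x) (at x)" if "x \<in> W" for x
    unfolding has_derivative_componentwise_within[of \<Phi> "Q x"]
    using g(2)[OF _ that] by (simp add: Q_inner)
  show thesis
  proof
    show "(\<Phi> has_derivative Q x) (at x)" if "x \<in> W" for x by (rule deriv[OF that])
    show "continuous_on W (\<lambda>x. Q x h)" for h
      unfolding Q_def by (intro continuous_intros g(1))
    fix u \<eta> assume u: "u \<in> W" and "(\<eta>::real) > 0"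
    \<comment> \<open>Two gradients within \<eta> / (2 N) of the one at \<open>u\<close> differ by
      less than \<eta> / N, and bounding the norm by the sum over the \<open>N\<close> coordinates
      brings this up to \<eta>.\<close>
    define N where "N = real DIM('a)"
    have "N > 0" by (simp add: N_def)
    have "eventually (\<lambda>x. \<forall>i\<in>Basis. dist (g i x) (g i u) < \<eta> / (2 * N)) (nhds u)"
    proof (rule eventually_ball_finite[OF finite_Basis], intro ballI)
      fix i :: 'a assume "i \<in> Basis"
      then have "isCont (g i) u"
        using g(1) \<open>open W\<close> u by (simp add: continuous_on_eq_continuous_at)
      then have "filterlim (g i) (nhds (g i u)) (nhds u)"
        by (simp add: isCont_def tendsto_at_iff_tendsto_nhds)
      then show "eventually (\<lambda>x. dist (g i x) (g i u) < \<eta> / (2 * N)) (nhds u)"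
        using \<open>\<eta> > 0\<close> \<open>N > 0\<close> by (intro tendstoD) auto
    qed
    moreover have "eventually (\<lambda>x. x \<in> W) (nhds u)"
      using \<open>open W\<close> u by (simp add: eventually_nhds_in_open)
    ultimately have "eventually (\<lambda>x. x \<in> W \<and> (\<forall>i\<in>Basis. dist (g i x) (g i u) < \<eta> / (2 * N))) (nhds u)"
      by eventually_elim auto
    then obtain \<epsilon> where "\<epsilon> > 0"
      and "\<forall>x. dist x u < \<epsilon> \<longrightarrow> x \<in> W \<and> (\<forall>i\<in>Basis. dist (g i x) (g i u) < \<eta> / (2 * N))"
      unfolding eventually_nhds_metric by blast
    then have \<epsilon>: "x \<in> W" "\<And>i. i \<in> Basis \<Longrightarrow> dist (g i x) (g i u) < \<eta> / (2 * N)"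
      if "x \<in> ball u \<epsilon>" for x
      using that by (auto simp: dist_commute)
    have "norm (\<Phi> w - \<Phi> v - Q v (w - v)) \<le> \<eta> * norm (w - v)"
      if v: "v \<in> ball u \<epsilon>" and w: "w \<in> ball u \<epsilon>" for v w
    proof -
      have "norm (\<Phi> w - \<Phi> v - Q v (w - v)) \<le> norm (w - v) * \<eta>"
      proof (rule differentiable_bound_linearization[where S = "ball u \<epsilon>" and f' = Q and ?x0.0 = v])
        show "v + t *\<^sub>R (w - v) \<in> ball u \<epsilon>" if "t \<in> {0..1}" for t
          using convexD_alt[OF convex_ball v w, of t] that by (simp add: algebra_simps)
        show "(\<Phi> has_derivative Q x) (at x within ball u \<epsilon>)" if "x \<in> ball u \<epsilon>" for x
          using deriv \<epsilon>(1)[OF that] has_derivative_at_withinI by blast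
        show "onorm (Q x - Q v) \<le> \<eta>" if x: "x \<in> ball u \<epsilon>" for x
        proof (rule onorm_le)
          fix h
          have "norm ((Q x - Q v) h) \<le> (\<Sum>i\<in>Basis. \<bar>(Q x - Q v) h \<bullet> i\<bar>)"
            by (rule norm_le_l1)
          also have "\<dots> \<le> (\<Sum>i\<in>(Basis::'a set). \<eta> / N * norm h)"
          proof (rule sum_mono)
            fix i :: 'a assume i: "i \<in> Basis"
            have "\<bar>(Q x - Q v) h \<bullet> i\<bar> = \<bar>(g i x - g i v) \<bullet> h\<bar>"
              using i by (simp add: inner_diff_left Q_inner)
            also have "\<dots> \<le> norm (g i x - g i v) * norm h"
              by (rule Cauchy_Schwarz_ineq2)
            also have "norm (g i x - g i v) \<le> \<eta> / N"
              using \<epsilon>(2)[OF x i] \<epsilon>(2)[OF v i] dist_triangle2[of "g i x" "g i v" "g i u"]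
              by (simp add: dist_norm)
            finally show "\<bar>(Q x - Q v) h \<bullet> i\<bar> \<le> \<eta> / N * norm h"
              by (simp add: mult_right_mono)
          qed
          also have "\<dots> = \<eta> * norm h"
            using \<open>N > 0\<close> by (simp add: N_def)
          finally show "norm ((Q x - Q v) h) \<le> \<eta> * norm h" .
        qed
      qed (rule v)
      then show ?thesis by (simp add: mult.commute)
    qed
    moreover have "ball u \<epsilon> \<subseteq> W" using \<epsilon>(1) by blast
    ultimately show "\<exists>\<epsilon>>0. ball u \<epsilon> \<subseteq> W \<and>
      (\<forall>v\<in>ball u \<epsilon>. \<forall>w\<in>ball u \<epsilon>. norm (\<Phi> w - \<Phi> v - Q v (w - v)) \<le> \<eta> * norm (w - v))"
      using \<open>\<epsilon> > 0\<close> by blast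
  qed
qed

text \<open>A curve in \<open>M\<close> is fixed by \<open>\<Phi>\<close> near 0, so by the chain
  rule its velocity is fixed by \<open>Q v\<close>. Conversely, \<open>\<Phi>\<close> maps the line
  \<open>v + t *\<^sub>R h\<close> to a curve in \<open>M\<close> with velocity
  \<open>Q v h\<close>.\<close>

lemma tangent_space_local_retract:
  fixes M :: "'a::euclidean_space set"
  assumes W: "open W" and \<Phi>_M: "\<And>x. x \<in> W \<Longrightarrow> \<Phi> x \<in> M"
    and \<Phi>_id: "\<And>x. x \<in> W \<Longrightarrow> x \<in> M \<Longrightarrow> \<Phi> x = x"
    and deriv: "\<And>x. x \<in> W \<Longrightarrow> (\<Phi> has_derivative Q x) (at x)"
    and cont: "\<And>h. continuous_on W (\<lambda>x. Q x h)"
    and v: "v \<in> W" "v \<in> M"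
  shows "tangent_space M v = range (Q v)"
proof (intro equalityI subsetI)
  fix \<xi> assume "\<xi> \<in> tangent_space M v"
  then obtain e \<gamma> where "e > 0" "\<gamma> ` {-e<..<e} \<subseteq> M" "\<gamma> 0 = v"
    and \<gamma>': "(\<gamma> has_vector_derivative \<xi>) (at 0)"
    unfolding tangent_space_def by blast
  have "isCont \<gamma> 0" using \<gamma>' by (rule has_vector_derivative_continuous)
  then have "filterlim \<gamma> (nhds v) (nhds 0)"
    unfolding isCont_def \<open>\<gamma> 0 = v\<close>
    using tendsto_at_iff_tendsto_nhds[of \<gamma> 0] \<open>\<gamma> 0 = v\<close> by simp
  then have "eventually (\<lambda>t. \<gamma> t \<in> W) (nhds 0)"
    using W v(1) by (rule topological_tendstoD)
  moreover have "eventually (\<lambda>t. t \<in> {-e<..<e}) (nhds 0)"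
    using \<open>e > 0\<close> by (intro eventually_nhds_in_open) auto
  ultimately have ev: "eventually (\<lambda>t. (\<Phi> \<circ> \<gamma>) t = \<gamma> t) (nhds 0)"
  proof eventually_elim
    case (elim t)
    then have "\<gamma> t \<in> M" using \<open>\<gamma> ` {-e<..<e} \<subseteq> M\<close> by blast
    then show ?case using \<Phi>_id elim by simp
  qed
  have "((\<Phi> \<circ> \<gamma>) has_vector_derivative Q v \<xi>) (at 0)"
    using vector_derivative_diff_chain_within[of \<gamma> \<xi> 0 UNIV \<Phi> "Q v"] \<gamma>' deriv[OF v(1)]
      has_derivative_at_withinI \<open>\<gamma> 0 = v\<close> by auto
  then have "(\<gamma> has_vector_derivative Q v \<xi>) (at 0)"
    using has_vector_derivative_cong_ev[where S = UNIV and f = "\<Phi> \<circ> \<gamma>" and g = \<gamma> and x = 0]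
      eventually_nhds_x_imp_x[OF ev] ev by simp
  then have "Q v \<xi> = \<xi>" using \<gamma>' vector_derivative_unique_at by blast
  then show "\<xi> \<in> range (Q v)" by (metis rangeI)
next
  fix \<xi> assume "\<xi> \<in> range (Q v)"
  then obtain h where h: "\<xi> = Q v h" by blast
  obtain \<epsilon> where "\<epsilon> > 0" "ball v \<epsilon> \<subseteq> W" using W v(1) openE by blast
  \<comment> \<open>The line stays in the ball for these parameters; the summand 1 covers
    \<open>h = 0\<close>.\<close>
  define e where "e = \<epsilon> / (norm h + 1)"
  have "e > 0" using \<open>\<epsilon> > 0\<close> by (simp add: e_def add_nonneg_pos)
  have in_W: "v + t *\<^sub>R h \<in> W" if "t \<in> {-e<..<e}" for t
  proof -
    have "\<bar>t\<bar> * norm h \<le> \<bar>t\<bar> * (norm h + 1)" by (simp add: mult_left_mono)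
    also have "\<dots> < e * (norm h + 1)"
      using that by (intro mult_strict_right_mono) (auto simp: add_nonneg_pos)
    also have "\<dots> = \<epsilon>"
      using norm_ge_zero[of h] by (simp add: e_def add_nonneg_eq_0_iff)
    finally show ?thesis using \<open>ball v \<epsilon> \<subseteq> W\<close> by (auto simp: dist_norm)
  qed
  define \<gamma> where "\<gamma> t = \<Phi> (v + t *\<^sub>R h)" for t
  have \<gamma>': "(\<gamma> has_vector_derivative Q (v + t *\<^sub>R h) h) (at t)" if "t \<in> {-e<..<e}" for t
  proof -
    have "((\<lambda>t. v + t *\<^sub>R h) has_vector_derivative h) (at t)"
      by (auto intro!: derivative_eq_intros)
    then have "((\<Phi> \<circ> (\<lambda>t. v + t *\<^sub>R h)) has_vector_derivative Q (v + t *\<^sub>R h) h) (at t)"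
      using vector_derivative_diff_chain_within[of "\<lambda>t. v + t *\<^sub>R h" h t UNIV \<Phi> "Q (v + t *\<^sub>R h)"]
        deriv[OF in_W[OF that]] has_derivative_at_withinI by auto
    then show ?thesis by (simp add: o_def \<gamma>_def [abs_def])
  qed
  have "continuous_on {-e<..<e} (\<lambda>t. Q (v + t *\<^sub>R h) h)"
  proof (rule continuous_on_compose2[OF cont[of h]])
    show "continuous_on {-e<..<e} (\<lambda>t. v + t *\<^sub>R h)" by (intro continuous_intros)
    show "(\<lambda>t. v + t *\<^sub>R h) ` {-e<..<e} \<subseteq> W" using in_W by (rule image_subsetI)
  qed
  then have "\<gamma> C1_differentiable_on {-e<..<e}"
    unfolding C1_differentiable_on_def
    by (intro exI[of _ "\<lambda>t. Q (v + t *\<^sub>R h) h"] conjI ballI \<gamma>')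
  moreover have "\<gamma> ` {-e<..<e} \<subseteq> M" using in_W \<Phi>_M by (auto simp: \<gamma>_def)
  moreover have "\<gamma> 0 = v" using v \<Phi>_id by (simp add: \<gamma>_def)
  moreover have "(\<gamma> has_vector_derivative \<xi>) (at 0)"
    using \<gamma>'[of 0] \<open>e > 0\<close> h by simp
  ultimately show "\<xi> \<in> tangent_space M v"
    unfolding tangent_space_def using \<open>e > 0\<close> by blast
qed

text \<open>Near \<open>u\<close> the manifold is the fixed-point set of \<open>\<Phi>\<close>,
  hence closed in a small ball. Compactness is what makes the constants of the retraction uniform
  there.\<close>

lemma local_retract_compact_nhd:
  fixes M :: "'a::euclidean_space set"
  assumes "open W" "u \<in> W" and "continuous_on W \<Phi>" and \<Phi>_M: "\<And>x. x \<in> W \<Longrightarrow> \<Phi> x \<in> M"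
    and \<Phi>_id: "\<And>x. x \<in> W \<Longrightarrow> x \<in> M \<Longrightarrow> \<Phi> x = x"
  obtains \<epsilon> where "\<epsilon> > 0" "compact (M \<inter> cball u \<epsilon>)"
proof -
  obtain \<epsilon> where "\<epsilon> > 0" and sub: "cball u \<epsilon> \<subseteq> W"
    using assms(1,2) open_contains_cball by blast
  have "M \<inter> cball u \<epsilon> = {x \<in> cball u \<epsilon>. \<Phi> x = x}"
  proof (intro equalityI subsetI)
    fix x assume "x \<in> {x \<in> cball u \<epsilon>. \<Phi> x = x}"
    then show "x \<in> M \<inter> cball u \<epsilon>" using \<Phi>_M[of x] sub by auto
  qed (use sub \<Phi>_id in auto)
  moreover have "closed {x \<in> cball u \<epsilon>. \<Phi> x = x}"
    using continuous_on_subset[OF assms(3) sub]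
    by (intro continuous_closed_preimage_constant[where f = "\<lambda>x. \<Phi> x - x" and a = 0, simplified]
        continuous_intros) auto
  ultimately have "closed (M \<inter> cball u \<epsilon>)" by argo
  then have "compact (M \<inter> cball u \<epsilon>)"
    using compact_Int_closed[OF compact_cball, of "M \<inter> cball u \<epsilon>" u \<epsilon>]
    by (simp add: Int_left_commute Int_absorb)
  then show thesis using that \<open>\<epsilon> > 0\<close> by blast
qed

section \<open>Bounded ranks under limits, and the ranks of tangent vectors\<close>

lemma rank_scaleR:
  fixes X :: "real^'n^'m"
  assumes "a \<noteq> 0"
  shows "rank (a *\<^sub>R X) = rank X"
proof (rule antisym)
  have le: "rank (a *\<^sub>R X) \<le> rank X" for a and X :: "real^'n^'m"
  proof -
    have "a *\<^sub>R X = (a *\<^sub>R mat 1) ** X"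
      by (simp add: vec_eq_iff matrix_matrix_mult_def mat_def if_distrib if_distribR cong: if_cong)
    then show ?thesis by (metis rank_mul_le_right)
  qed
  show "rank (a *\<^sub>R X) \<le> rank X" by (rule le)
  show "rank X \<le> rank (a *\<^sub>R X)" using le[of "inverse a" "a *\<^sub>R X"] assms by simp
qed

lemma rank_diff_le:
  fixes X Y :: "real^'n^'m"
  shows "rank (X - Y) \<le> rank X + rank Y"
proof -
  let ?S = "range ((*v) X)" and ?T = "range ((*v) Y)"
  have sub: "subspace ?S" "subspace ?T"
    by (auto intro!: real_vector.linear_subspace_image)
  have "(X - Y) *v z \<in> {x + y | x y. x \<in> ?S \<and> y \<in> ?T}" for z
  proof -
    have "(X - Y) *v z = X *v z + Y *v (- z)"
      by (simp add: matrix_vector_mult_diff_rdistrib vec.neg)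
    then show ?thesis by blast
  qed
  then have "rank (X - Y) \<le> dim {x + y | x y. x \<in> ?S \<and> y \<in> ?T}"
    unfolding rank_dim_range by (intro dim_subset) blast
  then show ?thesis
    using dim_sums_Int[OF sub] by (simp add: rank_dim_range)
qed

text \<open>The rank is at least that of \<open>U\<close> as long as the determinant of the
  perturbed identity is nonzero, which is an open condition on \<open>X\<close>.\<close>

lemma closed_rank_le: "closed {X :: real^'n^'n. rank X \<le> k}"
  unfolding closed_def
proof (subst open_subopen, intro ballI)
  fix U :: "real^'n^'n" assume "U \<in> - {X. rank X \<le> k}"
  then have U: "rank U > k" by simp
  obtain G where G: "U ** G ** U = U" using generalized_inverse_exists[of U] by blast
  let ?D = "{X. det (mat 1 + G ** (X - U)) \<noteq> 0}"
  have "continuous_on UNIV (\<lambda>X. det (mat 1 + G ** (X - U)))"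
    unfolding det_def matrix_matrix_mult_def
    by (auto intro!: continuous_intros simp: vector_add_component)
  then have "open ?D" by (intro open_Collect_neq continuous_on_const)
  moreover have "U \<in> ?D" by simp
  moreover have "?D \<subseteq> - {X. rank X \<le> k}"
    using kernel_image_under_perturbation(1)[OF G] U by fastforce
  ultimately show "\<exists>T. open T \<and> U \<in> T \<and> T \<subseteq> - {X. rank X \<le> k}" by blast
qed

lemma linear_matricisation: "linear (matricisation c \<alpha>)"
  by (rule linearI) (simp_all add: vec_eq_iff matricisation_component)

lemma closed_rank_le_tensors: "closed (rank_le_tensors c S r)"
proof -
  have "rank_le_tensors c S r = (\<Inter>\<alpha>\<in>S. matricisation c \<alpha> -` {X. rank X \<le> r \<alpha>})"
    by (auto simp: rank_le_tensors_def)
  moreover have "closed (matricisation c \<alpha> -` {X. rank X \<le> r \<alpha>})" for \<alpha>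
    by (intro closed_vimage closed_rank_le linear_continuous_on linear_linear[THEN iffD2] linear_matricisation)
  ultimately show ?thesis by auto
qed

text \<open>A tangent vector is a limit of difference quotients of two tensors of rank r; these have
  rank at most 2 r, and this bound survives limits.\<close>

lemma tangent_space_rank_le:
  assumes "\<xi> \<in> tangent_space (rank_eq_tensors c S r) v"
  shows "\<xi> \<in> rank_le_tensors c S (\<lambda>\<alpha>. 2 * r \<alpha>)"
proof -
  obtain e \<gamma> where "e > 0" and \<gamma>: "\<gamma> ` {-e<..<e} \<subseteq> rank_eq_tensors c S r"
    and \<gamma>': "(\<gamma> has_vector_derivative \<xi>) (at 0)"
    using assms unfolding tangent_space_def by blast
  \<comment> \<open>The limit is taken from the right, where \<open>norm t = t\<close> and the
    expression plus \<open>\<xi>\<close> is the difference quotient.\<close>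
  have "((\<lambda>t. (1 / norm t) *\<^sub>R (\<gamma> t - (\<gamma> 0 + t *\<^sub>R \<xi>))) \<longlongrightarrow> 0) (at_right 0)"
    using \<gamma>' unfolding has_vector_derivative_def has_derivative_at2
    by (auto intro: tendsto_mono[OF at_le])
  then have "((\<lambda>t. (1 / norm t) *\<^sub>R (\<gamma> t - (\<gamma> 0 + t *\<^sub>R \<xi>)) + \<xi>) \<longlongrightarrow> 0 + \<xi>) (at_right 0)"
    by (intro tendsto_intros)
  moreover have "eventually (\<lambda>t. t \<in> {0<..<e}) (at_right (0::real))"
    using \<open>e > 0\<close> by (rule eventually_at_right_real)
  then have "eventually (\<lambda>t. (1 / norm t) *\<^sub>R (\<gamma> t - (\<gamma> 0 + t *\<^sub>R \<xi>)) + \<xi>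
      \<in> rank_le_tensors c S (\<lambda>\<alpha>. 2 * r \<alpha>)) (at_right 0)"
  proof eventually_elim
    case (elim t)
    have "(1 / norm t) *\<^sub>R (\<gamma> t - (\<gamma> 0 + t *\<^sub>R \<xi>)) + \<xi> = (1 / t) *\<^sub>R (\<gamma> t - \<gamma> 0)"
      using elim by (simp add: algebra_simps)
    moreover have "\<gamma> t \<in> rank_eq_tensors c S r" "\<gamma> 0 \<in> rank_eq_tensors c S r"
      using \<gamma> elim \<open>e > 0\<close> by auto
    then have "rank (matricisation c \<alpha> (\<gamma> t - \<gamma> 0)) \<le> 2 * r \<alpha>" if "\<alpha> \<in> S" for \<alpha>
      using rank_diff_le[of "matricisation c \<alpha> (\<gamma> t)" "matricisation c \<alpha> (\<gamma> 0)"] that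
      by (simp add: matricisation_diff rank_eq_tensors_def)
    ultimately show ?case
      using elim by (simp add: rank_le_tensors_def matricisation_scaleR rank_scaleR)
  qed
  ultimately have "0 + \<xi> \<in> rank_le_tensors c S (\<lambda>\<alpha>. 2 * r \<alpha>)"
    by (intro Lim_in_closed_set[OF closed_rank_le_tensors _ trivial_limit_at_right_real])
  then show ?thesis by simp
qed

text \<open>Nonzero scaling preserves the ranks, so the manifold contains the open ray through
  \<open>v\<close>. It follows that the projection fixes \<open>v\<close>, and the step direction is
  the projection of the gradient term alone.\<close>

lemma rank_eq_tensors_self_tangent:
  assumes "v \<in> rank_eq_tensors c S r"
  shows "v \<in> tangent_space (rank_eq_tensors c S r) v"
proof -
  let ?\<gamma> = "\<lambda>t::real. (1 + t) *\<^sub>R v"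
  have \<gamma>': "(?\<gamma> has_vector_derivative v) (at t)" for t
    by (auto intro!: derivative_eq_intros)
  then have "?\<gamma> C1_differentiable_on {-1<..<1}"
    unfolding C1_differentiable_on_def by (intro exI[of _ "\<lambda>_. v"]) auto
  moreover have "?\<gamma> ` {-1<..<1} \<subseteq> rank_eq_tensors c S r"
    using assms by (auto simp: rank_eq_tensors_def matricisation_scaleR rank_scaleR)
  ultimately show ?thesis
    unfolding tangent_space_def using \<gamma>'[of 0]
    by (intro CollectI exI[of _ 1] conjI exI[of _ ?\<gamma>]) auto
qed

section \<open>The least restricted isometry constant\<close>

lemma trip_constant_bounds:
  fixes A :: "real^'i \<Rightarrow> real^'m"
  assumes "linear A" and "trip_constant c S k A \<le> \<delta>"
    and "w \<in> rank_le_tensors c S k" "w \<noteq> 0"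
  shows "0 \<le> \<delta>"
    and "v \<in> rank_le_tensors c S k \<Longrightarrow> \<bar>(norm (A v))\<^sup>2 - (norm v)\<^sup>2\<bar> \<le> \<delta> * (norm v)\<^sup>2"
proof -
  let ?K = "rank_le_tensors c S k"
  \<comment> \<open>\<open>LEAST\<close> over the reals says something only if the minimum is
    attained. \<open>D\<close> is closed, nonempty, and bounded below by 0 because of the nonzero
    \<open>w\<close>; so it contains its infimum.\<close>
  define D where "D = {\<delta>. \<forall>v\<in>?K.
    (1 - \<delta>) * (norm v)\<^sup>2 \<le> (norm (A v))\<^sup>2 \<and> (norm (A v))\<^sup>2 \<le> (1 + \<delta>) * (norm v)\<^sup>2}"
  have "D = (\<Inter>v\<in>?K. {\<delta>. (1 - \<delta>) * (norm v)\<^sup>2 \<le> (norm (A v))\<^sup>2} \<inter>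
      {\<delta>. (norm (A v))\<^sup>2 \<le> (1 + \<delta>) * (norm v)\<^sup>2})"
    by (auto simp: D_def)
  moreover have "closed ({\<delta>. (1 - \<delta>) * (norm v)\<^sup>2 \<le> (norm (A v))\<^sup>2} \<inter>
      {\<delta>. (norm (A v))\<^sup>2 \<le> (1 + \<delta>) * (norm v)\<^sup>2})" for v
    by (intro closed_Int closed_Collect_le continuous_intros)
  ultimately have "closed D" by auto
  have pos: "0 \<le> \<delta>" if "\<delta> \<in> D" for \<delta>
  proof -
    have "(1 - \<delta>) * (norm w)\<^sup>2 \<le> (1 + \<delta>) * (norm w)\<^sup>2"
      using that assms(3) unfolding D_def by fastforce
    then show ?thesis using assms(4) by simp
  qed
  then have bdd: "bdd_below D" by (rule bdd_belowI)
  obtain B where "\<And>x. norm (A x) \<le> B * norm x" using linear_bounded_pos[OF assms(1)] by blast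
  then have B: "(norm (A x))\<^sup>2 \<le> B\<^sup>2 * (norm x)\<^sup>2" for x
    by (metis norm_ge_zero power_mono power_mult_distrib)
  \<comment> \<open>For this constant the lower inequality has a nonpositive left side, and the
    operator bound gives the upper one.\<close>
  have "1 + B\<^sup>2 \<in> D"
    unfolding D_def
  proof (intro CollectI ballI conjI)
    fix v :: "real^'i"
    have "(1 - (1 + B\<^sup>2)) * (norm v)\<^sup>2 \<le> 0" by (simp add: mult_nonpos_nonneg)
    then show "(1 - (1 + B\<^sup>2)) * (norm v)\<^sup>2 \<le> (norm (A v))\<^sup>2"
      using zero_le_power2[of "norm (A v)"] by linarith
    show "(norm (A v))\<^sup>2 \<le> (1 + (1 + B\<^sup>2)) * (norm v)\<^sup>2"
      using add_increasing[OF _ B[of v], of "2 * (norm v)\<^sup>2"] by (simp add: distrib_right)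
  qed
  then have Inf: "Inf D \<in> D" using closed_contains_Inf[OF _ bdd \<open>closed D\<close>] by blast
  have "trip_constant c S k A = (LEAST \<delta>. \<delta> \<in> D)"
    by (simp add: trip_constant_def D_def)
  also have "\<dots> = Inf D"
    by (rule Least_equality) (use Inf cInf_lower[OF _ bdd] in auto)
  finally have le: "Inf D \<le> \<delta>" using assms(2) by simp
  then show "0 \<le> \<delta>" using pos[OF Inf] by simp
  assume v: "v \<in> ?K"
  have "Inf D * (norm v)\<^sup>2 \<le> \<delta> * (norm v)\<^sup>2" using le by (simp add: mult_right_mono)
  moreover have "(1 - Inf D) * (norm v)\<^sup>2 \<le> (norm (A v))\<^sup>2" "(norm (A v))\<^sup>2 \<le> (1 + Inf D) * (norm v)\<^sup>2"
    using Inf v by (auto simp: D_def)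
  ultimately show "\<bar>(norm (A v))\<^sup>2 - (norm v)\<^sup>2\<bar> \<le> \<delta> * (norm v)\<^sup>2"
    by (simp add: algebra_simps abs_le_iff)
qed

subsection \<open>Projected gradient steps\<close>

lemma orthogonal_projectionI:
  assumes "subspace T" "y \<in> T" "\<And>z. z \<in> T \<Longrightarrow> (x - y) \<bullet> z = 0"
  shows "orthogonal_projection T x = y"
  unfolding orthogonal_projection_def
proof (rule the_equality)
  fix y' assume y': "y' \<in> T \<and> (\<forall>z\<in>T. (x - y') \<bullet> z = 0)"
  have "y - y' \<in> T" using assms(1,2) y' by (blast intro: subspace_diff)
  then have "(x - y') \<bullet> (y - y') - (x - y) \<bullet> (y - y') = 0"
    using y' assms(3) by simp
  then have "(y - y') \<bullet> (y - y') = 0"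
    by (simp add: inner_diff_left)
  then show "y' = y" by simp
qed (use assms in auto)

lemma orthogonal_projection_props:
  assumes "subspace T"
  shows "orthogonal_projection T x \<in> T"
    and "z \<in> T \<Longrightarrow> (x - orthogonal_projection T x) \<bullet> z = 0"
proof -
  obtain y w where "y \<in> span T" "\<And>z. z \<in> span T \<Longrightarrow> orthogonal w z" "x = y + w"
    using orthogonal_subspace_decomp_exists[of T x] by blast
  then have y: "y \<in> T" "\<And>z. z \<in> T \<Longrightarrow> (x - y) \<bullet> z = 0"
    using span_eq_iff[THEN iffD2, OF assms] by (auto simp: orthogonal_def)
  then have "orthogonal_projection T x = y" by (rule orthogonal_projectionI[OF assms])
  with y show "orthogonal_projection T x \<in> T"
    and "z \<in> T \<Longrightarrow> (x - orthogonal_projection T x) \<bullet> z = 0" by auto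
qed

lemma orthogonal_projection_add:
  assumes "subspace T"
  shows "orthogonal_projection T (x + y) = orthogonal_projection T x + orthogonal_projection T y"
  by (rule orthogonal_projectionI[OF assms])
    (auto simp: add_diff_add inner_add_left assms orthogonal_projection_props intro: subspace_add)

lemma orthogonal_projection_id:
  assumes "subspace T" "x \<in> T"
  shows "orthogonal_projection T x = x"
  using assms by (intro orthogonal_projectionI) auto

lemma norm_diff_orthogonal_projection_le:
  assumes "subspace T" "\<zeta> \<in> T"
  shows "norm (x - orthogonal_projection T x) \<le> norm (x - \<zeta>)"
proof -
  let ?P = "orthogonal_projection T x"
  have "(x - ?P) \<bullet> (?P - \<zeta>) = 0"
    using assms by (intro orthogonal_projection_props subspace_diff)
  then have "(norm ((x - ?P) + (?P - \<zeta>)))\<^sup>2 = (norm (x - ?P))\<^sup>2 + (norm (?P - \<zeta>))\<^sup>2"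
    by (intro norm_add_Pythagorean) (simp add: orthogonal_def)
  then have "(norm (x - ?P))\<^sup>2 \<le> (norm (x - \<zeta>))\<^sup>2" by simp
  then show ?thesis by (rule power2_le_imp_le) simp
qed

lemma norm_orthogonal_projection_le:
  assumes "subspace T"
  shows "norm (orthogonal_projection T x) \<le> norm x"
proof -
  let ?P = "orthogonal_projection T x"
  have "(x - ?P) \<bullet> ?P = 0"
    using assms by (intro orthogonal_projection_props)
  then have "(norm ((x - ?P) + ?P))\<^sup>2 = (norm (x - ?P))\<^sup>2 + (norm ?P)\<^sup>2"
    by (intro norm_add_Pythagorean) (simp add: orthogonal_def)
  then have "(norm ?P)\<^sup>2 \<le> (norm x)\<^sup>2" by simp
  then show ?thesis by (rule power2_le_imp_le) simp
qed

text \<open>Polarization: the defect of the inner product is a difference of isometry defects at the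
  sum and the difference of the vectors, both in \<open>T\<close>. The parallelogram law adds up
  their bounds.\<close>

lemma restricted_isometry_inner_le:
  assumes "linear A" "subspace T"
    and rip: "\<And>v. v \<in> T \<Longrightarrow> \<bar>(norm (A v))\<^sup>2 - (norm v)\<^sup>2\<bar> \<le> \<delta> * (norm v)\<^sup>2"
    and z: "z \<in> T" and w: "w \<in> T"
  shows "A z \<bullet> A w - z \<bullet> w \<le> \<delta> * norm z * norm w"
proof (cases "z = 0 \<or> w = 0")
  case True
  then show ?thesis using linear_0[OF assms(1)] by auto
next
  case False
  let ?a = "norm z" and ?b = "norm w"
  \<comment> \<open>Both vectors get the norm \<open>?a * ?b\<close>; without this scaling the
    parallelogram law would yield the mean of the squared norms instead of their product.\<close>
  let ?x = "?b *\<^sub>R z" and ?y = "?a *\<^sub>R w"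
  have T: "?x \<in> T" "?y \<in> T" using assms(2) z w by (auto intro: subspace_scale)
  have "4 * (A ?x \<bullet> A ?y - ?x \<bullet> ?y)
      = ((norm (A (?x + ?y)))\<^sup>2 - (norm (?x + ?y))\<^sup>2) - ((norm (A (?x - ?y)))\<^sup>2 - (norm (?x - ?y))\<^sup>2)"
    unfolding linear_add[OF assms(1)] linear_diff[OF assms(1)] power2_norm_eq_inner
    by (simp add: inner_add_left inner_add_right inner_diff_left inner_diff_right inner_commute)
  also have "\<dots> \<le> \<delta> * (norm (?x + ?y))\<^sup>2 + \<delta> * (norm (?x - ?y))\<^sup>2"
    using rip[OF subspace_add[OF assms(2) T]] rip[OF subspace_diff[OF assms(2) T]] by linarith
  also have "\<dots> = 2 * \<delta> * ((norm ?x)\<^sup>2 + (norm ?y)\<^sup>2)"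
    unfolding power2_norm_eq_inner
    by (simp add: inner_add_left inner_add_right inner_diff_left inner_diff_right inner_commute
        algebra_simps)
  also have "\<dots> = 4 * (\<delta> * (?a * ?b)\<^sup>2)"
    by (simp add: power_mult_distrib)
  finally have "A ?x \<bullet> A ?y - ?x \<bullet> ?y \<le> \<delta> * (?a * ?b)\<^sup>2"
    by (simp only: mult_le_cancel_left_pos zero_less_numeral)
  moreover have "A ?x \<bullet> A ?y - ?x \<bullet> ?y = (?a * ?b) * (A z \<bullet> A w - z \<bullet> w)"
    by (simp add: linear_scale[OF assms(1)] algebra_simps)
  ultimately have "(?a * ?b) * (A z \<bullet> A w - z \<bullet> w) \<le> (?a * ?b) * (\<delta> * ?a * ?b)"
    by (simp add: power2_eq_square algebra_simps)
  moreover have "?a * ?b > 0" using False by simp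
  ultimately show ?thesis using mult_le_cancel_left_pos by blast
qed

text \<open>The vector to be estimated, \<open>w\<close>, lies in \<open>T\<close>, so the
  projection drops out of its inner product with itself: the squared norm of \<open>w\<close> equals
  \<open>A z \<bullet> A w - z \<bullet> w\<close>.\<close>

lemma restricted_isometry_projected_normal_map:
  fixes A :: "'a::euclidean_space \<Rightarrow> 'b::euclidean_space"
  assumes "linear A" "subspace T" "0 \<le> \<delta>"
    and rip: "\<And>v. v \<in> T \<Longrightarrow> \<bar>(norm (A v))\<^sup>2 - (norm v)\<^sup>2\<bar> \<le> \<delta> * (norm v)\<^sup>2"
    and z: "z \<in> T"
  shows "norm (orthogonal_projection T (adjoint A (A z)) - z) \<le> \<delta> * norm z"
proof -
  let ?g = "adjoint A (A z)"
  define w where "w = orthogonal_projection T ?g - z"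
  have w: "w \<in> T"
    unfolding w_def using assms(2) z by (intro subspace_diff orthogonal_projection_props)
  have "norm w * norm w = w \<bullet> w" by (simp add: dot_square_norm power2_eq_square)
  also have "\<dots> = (?g - z) \<bullet> w - (?g - orthogonal_projection T ?g) \<bullet> w"
    by (simp add: w_def inner_diff_left)
  also have "\<dots> = A z \<bullet> A w - z \<bullet> w"
    using orthogonal_projection_props(2)[OF assms(2) w]
    by (simp add: inner_diff_left adjoint_clauses[OF assms(1)])
  also have "\<dots> \<le> (\<delta> * norm z) * norm w"
    using restricted_isometry_inner_le[OF assms(1,2) rip z w] by simp
  finally show ?thesis
    using assms(3) unfolding w_def[symmetric]
    by (cases "w = 0") (auto simp: mult_le_cancel_right)
qed

text \<open>Split \<open>e = u - v\<close> into its tangential part \<open>z\<close> and the rest,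
  of norm at most \<open>\<eta> * norm e\<close>. The part \<open>z\<close> is contracted by
  \<delta>; the rest enters once through \<open>adjoint A \<circ> A\<close>, costing L, and once
  directly, costing 1.\<close>

lemma projected_gradient_step:
  fixes A :: "'a::euclidean_space \<Rightarrow> 'b::euclidean_space"
  assumes A: "linear A" and T: "subspace T" and "0 \<le> \<delta>"
    and rip: "\<And>x. x \<in> T \<Longrightarrow> \<bar>(norm (A x))\<^sup>2 - (norm x)\<^sup>2\<bar> \<le> \<delta> * (norm x)\<^sup>2"
    and L: "0 \<le> L" "\<And>x. norm (adjoint A (A x)) \<le> L * norm x"
    and v: "v \<in> T" and \<zeta>: "\<zeta> \<in> T" "norm (u - v - \<zeta>) \<le> \<eta> * norm (u - v)"
  defines "\<xi> \<equiv> orthogonal_projection T (v + adjoint A (A u - A v)) - v"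
  shows "\<xi> \<in> T" and "norm \<xi> \<le> L * norm (u - v)"
    and "norm (v + \<xi> - u) \<le> (\<delta> + (L + 1) * \<eta>) * norm (u - v)"
proof -
  let ?P = "orthogonal_projection T"
  define e where "e = u - v"
  define z where "z = ?P e"
  have z: "z \<in> T" unfolding z_def using T by (rule orthogonal_projection_props)
  have \<xi>: "\<xi> = ?P (adjoint A (A e))"
    unfolding \<xi>_def e_def
    using orthogonal_projection_add[OF T, of v] orthogonal_projection_id[OF T v]
    by (simp add: linear_diff[OF A])
  show "\<xi> \<in> T" unfolding \<xi> using T by (rule orthogonal_projection_props)
  show "norm \<xi> \<le> L * norm (u - v)"
    unfolding \<xi> using norm_orthogonal_projection_le[OF T] L(2)[of e]
    by (metis e_def order_trans)
  have ez: "norm (e - z) \<le> \<eta> * norm e"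
    using norm_diff_orthogonal_projection_le[OF T \<zeta>(1), of e] \<zeta>(2) by (simp add: e_def z_def)
  have "A e = A z + A (e - z)" by (simp flip: linear_add[OF A])
  then have "\<xi> = ?P (adjoint A (A z)) + ?P (adjoint A (A (e - z)))"
    unfolding \<xi> by (simp add: linear_add[OF adjoint_linear[OF A]] orthogonal_projection_add[OF T])
  then have "v + \<xi> - u = (?P (adjoint A (A z)) - z) + ?P (adjoint A (A (e - z))) - (e - z)"
    by (simp add: e_def)
  then have "norm (v + \<xi> - u) \<le> norm (?P (adjoint A (A z)) - z)
      + norm (?P (adjoint A (A (e - z)))) + norm (e - z)"
    using norm_triangle_ineq4[of "(?P (adjoint A (A z)) - z) + ?P (adjoint A (A (e - z)))" "e - z"]
      norm_triangle_ineq[of "?P (adjoint A (A z)) - z" "?P (adjoint A (A (e - z)))"] by simp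
  also have "\<dots> \<le> \<delta> * norm z + L * norm (e - z) + norm (e - z)"
    using restricted_isometry_projected_normal_map[OF A T \<open>0 \<le> \<delta>\<close> rip z]
      norm_orthogonal_projection_le[OF T, of "adjoint A (A (e - z))"] L(2)[of "e - z"] by linarith
  also have "\<dots> = \<delta> * norm z + (L + 1) * norm (e - z)" by (simp add: algebra_simps)
  also have "\<dots> \<le> \<delta> * norm e + (L + 1) * (\<eta> * norm e)"
    using norm_orthogonal_projection_le[OF T, of e] ez \<open>0 \<le> \<delta>\<close> L(1)
    by (intro add_mono mult_left_mono) (auto simp: z_def)
  finally show "norm (v + \<xi> - u) \<le> (\<delta> + (L + 1) * \<eta>) * norm (u - v)"
    by (simp add: algebra_simps e_def)
qed

section \<open>Contraction near a regular point, and the linear rate\<close>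

lemma riemannian_gradient_local_contraction:
  fixes A :: "real^'i \<Rightarrow> real^'m::finite" and c :: "'i::finite \<Rightarrow> nat \<Rightarrow> nat"
    and S :: "nat set set" and r :: "nat set \<Rightarrow> nat"
  defines "M \<equiv> rank_eq_tensors c S r"
  assumes c: "multi_indexing d n c" and S: "hierarchical_format d S"
    and R: "manifold_retraction M R" and A: "linear A" and \<delta>: "0 \<le> \<delta>" "\<delta> < 1"
    and rip: "\<And>x. x \<in> rank_le_tensors c S (\<lambda>\<alpha>. 3 * r \<alpha>) \<Longrightarrow>
      \<bar>(norm (A x))\<^sup>2 - (norm x)\<^sup>2\<bar> \<le> \<delta> * (norm x)\<^sup>2"
    and u: "u \<in> M"
  obtains \<epsilon> where "\<epsilon> > 0"
    "\<And>v. v \<in> M \<Longrightarrow> norm (v - u) \<le> \<epsilon> \<Longrightarrow>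
      (let v' = R v (orthogonal_projection (tangent_space M v) (v + adjoint A (A u - A v)) - v)
       in v' \<in> M \<and> norm (v' - u) \<le> (1 + \<delta>) / 2 * norm (v - u))"
proof -
  obtain W \<Phi> where W: "open W" "u \<in> W" "\<And>x. x \<in> W \<Longrightarrow> \<Phi> x \<in> M"
      "\<And>x. x \<in> W \<Longrightarrow> x \<in> M \<Longrightarrow> \<Phi> x = x"
    and C1: "\<And>i. i \<in> Basis \<Longrightarrow> C1_scalar_on W (\<lambda>x. \<Phi> x \<bullet> i)"
    using rank_eq_tensors_local_retraction[OF c S u[unfolded M_def]] unfolding M_def by blast
  obtain Q where Q: "\<And>x. x \<in> W \<Longrightarrow> (\<Phi> has_derivative Q x) (at x)"
    and Q_cont: "\<And>h. continuous_on W (\<lambda>x. Q x h)"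
    and Q_approx: "\<And>u \<eta>. u \<in> W \<Longrightarrow> \<eta> > 0 \<Longrightarrow> \<exists>\<epsilon>>0. ball u \<epsilon> \<subseteq> W \<and>
      (\<forall>v\<in>ball u \<epsilon>. \<forall>w\<in>ball u \<epsilon>. norm (\<Phi> w - \<Phi> v - Q v (w - v)) \<le> \<eta> * norm (w - v))"
    using C1_components_derivative[OF W(1) C1] by blast
  have tangent: "tangent_space M v = range (Q v)" if "v \<in> W" "v \<in> M" for v
    using tangent_space_local_retract[OF W(1,3,4) Q Q_cont that] .
  have "continuous_on W \<Phi>"
    using Q by (meson continuous_at_imp_continuous_on has_derivative_continuous)
  then obtain \<epsilon>1 where "\<epsilon>1 > 0" and compact: "compact (M \<inter> cball u \<epsilon>1)"
    using local_retract_compact_nhd[OF W(1,2) _ W(3,4)] by blast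
  have "linear (adjoint A \<circ> A)"
    using A by (intro linear_compose adjoint_linear)
  then obtain L where "L > 0" and L: "\<And>x. norm (adjoint A (A x)) \<le> L * norm x"
    using linear_bounded_pos[of "adjoint A \<circ> A"] by (metis comp_apply)
  \<comment> \<open>Chosen so that the non-tangential part, weighted by L + 1, costs a quarter of 1
    - \<delta>.\<close>
  define \<eta> where "\<eta> = (1 - \<delta>) / (4 * (L + 1))"
  have "\<eta> > 0" using \<delta> \<open>L > 0\<close> by (simp add: \<eta>_def)
  obtain \<epsilon>2 where "\<epsilon>2 > 0" "ball u \<epsilon>2 \<subseteq> W"
    and \<epsilon>2: "\<And>v w. v \<in> ball u \<epsilon>2 \<Longrightarrow> w \<in> ball u \<epsilon>2 \<Longrightarrow>
      norm (\<Phi> w - \<Phi> v - Q v (w - v)) \<le> \<eta> * norm (w - v)"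
    using Q_approx[OF W(2) \<open>\<eta> > 0\<close>] by blast
  obtain C0 \<tau> where "\<tau> > 0"
    and C0: "\<And>v \<xi>. v \<in> M \<inter> cball u \<epsilon>1 \<Longrightarrow> \<xi> \<in> tangent_space M v \<Longrightarrow> norm \<xi> \<le> \<tau> \<Longrightarrow>
      norm (v + \<xi> - R v \<xi>) \<le> C0 * (norm \<xi>)\<^sup>2"
    using R compact unfolding manifold_retraction_def by (meson inf_le1)
  define C where "C = \<bar>C0\<bar> + 1"
  have "C > 0" by (simp add: C_def)
  \<comment> \<open>In order: compactness of the manifold near \<open>u\<close>; room inside the
    open ball of radius \<open>\<epsilon>2\<close>; the threshold \<tau> for a step of norm at most
    L \<epsilon>; and a quadratic retraction error below a quarter of 1 - \<delta> times the current
    error.\<close>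
  define \<epsilon> where "\<epsilon> = Min {\<epsilon>1, \<epsilon>2 / 2, \<tau> / L, (1 - \<delta>) / (4 * C * L\<^sup>2)}"
  have "\<epsilon> > 0"
    using \<delta> \<open>\<epsilon>1 > 0\<close> \<open>\<epsilon>2 > 0\<close> \<open>\<tau> > 0\<close> \<open>L > 0\<close> \<open>C > 0\<close> by (simp add: \<epsilon>_def)
  have \<epsilon>: "\<epsilon> \<le> \<epsilon>1" "\<epsilon> < \<epsilon>2" "L * \<epsilon> \<le> \<tau>" "C * L\<^sup>2 * \<epsilon> \<le> (1 - \<delta>) / 4"
  proof -
    have "\<epsilon> \<le> \<epsilon>2 / 2" "\<epsilon> \<le> \<tau> / L" "\<epsilon> \<le> (1 - \<delta>) / (4 * C * L\<^sup>2)"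
      unfolding \<epsilon>_def by (intro Min_le; simp)+
    then show "\<epsilon> < \<epsilon>2" "L * \<epsilon> \<le> \<tau>" "C * L\<^sup>2 * \<epsilon> \<le> (1 - \<delta>) / 4"
      using \<open>\<epsilon>2 > 0\<close> \<open>L > 0\<close> \<open>C > 0\<close> by (simp_all add: field_simps)
  qed (simp add: \<epsilon>_def)
  show thesis
  proof (rule that[OF \<open>\<epsilon> > 0\<close>])
    fix v assume v: "v \<in> M" "norm (v - u) \<le> \<epsilon>"
    let ?T = "tangent_space M v"
    define \<xi> where "\<xi> = orthogonal_projection ?T (v + adjoint A (A u - A v)) - v"
    define e where "e = norm (u - v)"
    have e: "0 \<le> e" "e \<le> \<epsilon>" using v(2) by (simp_all add: e_def norm_minus_commute)
    have v_ball: "v \<in> ball u \<epsilon>2" "v \<in> M \<inter> cball u \<epsilon>1"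
      using v e \<epsilon> by (auto simp: dist_norm e_def)
    then have vW: "v \<in> W" using \<open>ball u \<epsilon>2 \<subseteq> W\<close> by blast
    have T: "subspace ?T"
      unfolding tangent[OF vW v(1)] using has_derivative_linear[OF Q[OF vW]]
      by (intro real_vector.linear_subspace_image) auto
    have T_rip: "\<bar>(norm (A x))\<^sup>2 - (norm x)\<^sup>2\<bar> \<le> \<delta> * (norm x)\<^sup>2" if "x \<in> ?T" for x
    proof (rule rip)
      show "x \<in> rank_le_tensors c S (\<lambda>\<alpha>. 3 * r \<alpha>)"
        using tangent_space_rank_le[OF that[unfolded M_def]] by (force simp: rank_le_tensors_def)
    qed
    \<comment> \<open>\<open>\<Phi>\<close> fixes both \<open>u\<close> and \<open>v\<close>, so
      \<open>u - v\<close> is an increment of \<open>\<Phi>\<close> and differs little from its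
      linearization at \<open>v\<close>, which is tangent.\<close>
    have approx: "norm (u - v - Q v (u - v)) \<le> \<eta> * norm (u - v)"
      using \<epsilon>2[OF v_ball(1), of u] \<open>\<epsilon>2 > 0\<close> W(4)[OF W(2) u] W(4)[OF vW v(1)] by simp
    have "Q v (u - v) \<in> ?T" by (simp add: tangent[OF vW v(1)])
    note step = projected_gradient_step[OF A T \<delta>(1) T_rip less_imp_le[OF \<open>L > 0\<close>] L
        rank_eq_tensors_self_tangent[OF v(1)[unfolded M_def], folded M_def] this approx,
        folded \<xi>_def e_def]
    have "norm \<xi> \<le> \<tau>"
      using step(2) \<epsilon>(3) mult_left_mono[OF e(2), of L] \<open>L > 0\<close> by linarith
    then have "norm (v + \<xi> - R v \<xi>) \<le> C0 * (norm \<xi>)\<^sup>2"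
      using C0[OF v_ball(2) step(1)] by blast
    also have "\<dots> \<le> C * (L * e)\<^sup>2"
      using step(2) by (intro mult_mono power_mono) (auto simp: C_def)
    also have "\<dots> = (C * L\<^sup>2 * e) * e" by (simp add: power2_eq_square)
    also have "\<dots> \<le> (C * L\<^sup>2 * \<epsilon>) * e"
      using e \<open>C > 0\<close> by (intro mult_right_mono mult_left_mono) auto
    also have "\<dots> \<le> (1 - \<delta>) / 4 * e" using \<epsilon>(4) e(1) by (rule mult_right_mono)
    finally have 1: "norm (v + \<xi> - R v \<xi>) \<le> (1 - \<delta>) / 4 * e" .
    have "(L + 1) * \<eta> = (1 - \<delta>) / 4" using \<open>L > 0\<close> by (simp add: \<eta>_def field_simps)
    then have 2: "norm (v + \<xi> - u) \<le> (\<delta> + (1 - \<delta>) / 4) * e" using step(3) by (simp only:)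
    have "norm (R v \<xi> - u) \<le> norm (v + \<xi> - u) + norm (v + \<xi> - R v \<xi>)"
      using norm_triangle_ineq4[of "v + \<xi> - u" "v + \<xi> - R v \<xi>"] by simp
    also have "\<dots> \<le> (\<delta> + (1 - \<delta>) / 4) * e + (1 - \<delta>) / 4 * e" using 1 2 by linarith
    also have "\<dots> = (1 + \<delta>) / 2 * norm (v - u)"
      by (simp add: e_def norm_minus_commute field_simps)
    finally have "norm (R v \<xi> - u) \<le> (1 + \<delta>) / 2 * norm (v - u)" .
    moreover have "R v \<xi> \<in> M"
      using R v(1) step(1) unfolding manifold_retraction_def by blast
    ultimately show "let v' = R v (orthogonal_projection ?T (v + adjoint A (A u - A v)) - v)
       in v' \<in> M \<and> norm (v' - u) \<le> (1 + \<delta>) / 2 * norm (v - u)"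
      by (simp add: \<xi>_def)
  qed
qed

theorem theorem3:
  fixes d :: nat and n :: "nat \<Rightarrow> nat" and c :: "'i::finite \<Rightarrow> nat \<Rightarrow> nat"
    and S :: "nat set set" and r :: "nat set \<Rightarrow> nat"
    and R :: "real^'i \<Rightarrow> real^'i \<Rightarrow> real^'i"
    and A :: "real^'i \<Rightarrow> real^'m::finite" and \<delta> :: real
    and u :: "real^'i" and b :: "real^'m"
  assumes "d \<ge> 2" and "\<forall>i\<in>{1..d}. n i \<ge> 1"
    and "multi_indexing d n c"
    and "hierarchical_format d S"
    and "\<forall>\<alpha>\<in>S. r \<alpha> \<ge> 1"
    and "manifold_retraction (rank_eq_tensors c S r) R"
    and "linear A"
    and "trip_constant c S (\<lambda>\<alpha>. 3 * r \<alpha>) A \<le> \<delta>" and "\<delta> < 1"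
    and "u \<in> rank_le_tensors c S r"
    and "b = A u"
  shows "\<exists>\<epsilon>0>0. \<forall>\<epsilon>\<in>{0<..\<epsilon>0}. \<exists>\<rho>\<in>{0<..<1}. \<forall>u0\<in>rank_eq_tensors c S r.
    norm (u - u0) \<le> \<epsilon> \<and> \<epsilon> < infdist u0 (singular_tensors c S r) \<longrightarrow>
    (\<forall>k. norm (riemannian_gradient_iteration (rank_eq_tensors c S r) R A b u0 (Suc k) - u)
       \<le> \<rho> * norm (riemannian_gradient_iteration (rank_eq_tensors c S r) R A b u0 k - u))"
proof -
  let ?M = "rank_eq_tensors c S r" and ?sing = "singular_tensors c S r"
  show ?thesis
  proof (cases "u \<in> ?M \<and> ?sing \<noteq> {}")
    case False
    have "\<not> (norm (u - u0) \<le> \<epsilon> \<and> \<epsilon> < infdist u0 ?sing)" if "\<epsilon> > 0" for u0 \<epsilon>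
    proof (cases "?sing = {}")
      case True
      \<comment> \<open>\<open>infdist\<close> to the empty set is 0 by convention, so it cannot
        exceed \<epsilon>.\<close>
      then show ?thesis using that by (simp add: infdist_def)
    next
      case nonempty: False
      then have "u \<in> ?sing" using False assms(10) by (auto simp: singular_tensors_def)
      then have "infdist u0 ?sing \<le> norm (u - u0)"
        using infdist_le[of u ?sing u0] by (simp add: dist_norm norm_minus_commute)
      then show ?thesis by linarith
    qed
    \<comment> \<open>With no admissible initial guess, the radius 1 and the rate 1/2 are arbitrary
      choices.\<close>
    then show ?thesis by (intro exI[of _ 1] conjI ballI bexI[of _ "1/2"]) auto
  next
    case True
    then have u: "u \<in> ?M" by blast
    \<comment> \<open>A singular tensor violates a rank equation at some node, and at that node r >=
      1 excludes \<open>u = 0\<close>. The nonzero \<open>u\<close> then serves as the witness that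
      bounds the isometry constants below.\<close>
    from True have "S \<noteq> {}"
      by (auto simp: singular_tensors_def rank_le_tensors_def rank_eq_tensors_def)
    then obtain \<alpha> where "\<alpha> \<in> S" by blast
    have "u \<noteq> 0"
    proof
      assume "u = 0"
      then have "matricisation c \<alpha> u = 0" using linear_0[OF linear_matricisation] by blast
      then have "r \<alpha> = 0" using u \<open>\<alpha> \<in> S\<close> by (auto simp: rank_eq_tensors_def)
      then show False using assms(5) \<open>\<alpha> \<in> S\<close> by auto
    qed
    moreover have "u \<in> rank_le_tensors c S (\<lambda>\<alpha>. 3 * r \<alpha>)"
      using assms(10) by (force simp: rank_le_tensors_def)
    ultimately have \<delta>: "0 \<le> \<delta>"
      and rip: "\<And>x. x \<in> rank_le_tensors c S (\<lambda>\<alpha>. 3 * r \<alpha>) \<Longrightarrow>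
        \<bar>(norm (A x))\<^sup>2 - (norm x)\<^sup>2\<bar> \<le> \<delta> * (norm x)\<^sup>2"
      using trip_constant_bounds[OF assms(7,8)] by blast+
    obtain \<epsilon>0 where "\<epsilon>0 > 0"
      and step: "\<And>v. v \<in> ?M \<Longrightarrow> norm (v - u) \<le> \<epsilon>0 \<Longrightarrow>
        (let v' = R v (orthogonal_projection (tangent_space ?M v) (v + adjoint A (A u - A v)) - v)
         in v' \<in> ?M \<and> norm (v' - u) \<le> (1 + \<delta>) / 2 * norm (v - u))"
      using riemannian_gradient_local_contraction[OF assms(3,4,6,7) \<delta> assms(9) rip u] by blast
    have "norm (riemannian_gradient_iteration ?M R A b u0 (Suc k) - u)
        \<le> (1 + \<delta>) / 2 * norm (riemannian_gradient_iteration ?M R A b u0 k - u)"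
      if "u0 \<in> ?M" "norm (u - u0) \<le> \<epsilon>0" for u0 k
    proof -
      let ?it = "riemannian_gradient_iteration ?M R A b u0"
      have next_it: "?it (Suc k) \<in> ?M \<and> norm (?it (Suc k) - u) \<le> (1 + \<delta>) / 2 * norm (?it k - u)"
        if "?it k \<in> ?M \<and> norm (?it k - u) \<le> \<epsilon>0" for k
        using step[of "?it k"] that by (simp add: Let_def assms(11))
      have "?it k \<in> ?M \<and> norm (?it k - u) \<le> \<epsilon>0" for k
      proof (induction k)
        case 0
        then show ?case using that by (simp add: norm_minus_commute)
      next
        case (Suc k)
        \<comment> \<open>A factor of at most 1 keeps the next iterate in the ball where the
          contraction applies.\<close>
        have "(1 + \<delta>) / 2 * norm (?it k - u) \<le> 1 * norm (?it k - u)"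
          using assms(9) by (intro mult_right_mono) auto
        then show ?case using next_it[OF Suc] Suc by linarith
      qed
      then show ?thesis using next_it by blast
    qed
    moreover have "(1 + \<delta>) / 2 \<in> {0<..<1}" using \<delta> assms(9) by auto
    ultimately show ?thesis
      using \<open>\<epsilon>0 > 0\<close>
      by (intro exI[of _ \<epsilon>0] conjI ballI bexI[of _ "(1 + \<delta>) / 2"]) auto
  qed
qed

end
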